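(* Let $n\ge 2$ and $r\ge 1$ be integers. The group of units of the monoid $C_{n,r}=\mathsf{D}(P_{n,r})$, the Boolean completion of the extended polycyclic inverse semigroup $P_{n,r}$, is (isomorphic to) the Higman-Thompson group $G_{n,r}$.
   Context: Polycyclic monoid. For $n\ge2$, $P_n$ is the monoid with zero presented by $\langle a_1,\ldots,a_n,a_1^{-1},\ldots,a_n^{-1} : a_i^{-1}a_i=1,\ a_i^{-1}a_j=0\ (i\neq j)\rangle$. Its non-zero elements are uniquely of the form $yx^{-1}$ with $x,y\in A^*$, the free monoid on $A=\{a_1,\ldots,a_n\}$; $yx^{-1}\cdot vu^{-1}$ equals $yzu^{-1}$ if $v=xz$, equals $y(uz)^{-1}$ if $x=vz$, and is $0$ otherwise. It is an inverse monoid. Extended polycyclic semigroup. For an inverse monoid $M$ with zero, $B_r(M)$ consists of a zero and the triples $(i,m,j)$ with $1\le i,j\le r$ and $0\ne m\in M$; the product $(i,m,j)(k,p,l)$ is $(i,mp,l)$ if $j=k$ and $mp\neq0$, and is zero otherwise. $P_{n,r}=B_r(P_n)$. This is an inverse semigroup in which each pair of elements has a meet in the natural partial order. Distributive completion. Let $S$ be an inverse semigroup with zero in which all pairs have meets in the natural partial order ($s\le t$ iff $s=te$ for some idempotent $e$). Elements $s,t$ are compatible if $s^{-1}t$ and $st^{-1}$ are idempotents. Write $\{a_1,\ldots,a_m\}\rightarrow\{b_1,\ldots,b_k\}$ if for each $i$ and each non-zero $x\le a_i$ there is $j$ with $x\wedge b_j\ne0$; $\leftrightarrow$ means both directions. On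 elements, $\leftrightarrow$ is a congruence on $S$; put $\mathbf{S}=S/\!\leftrightarrow$. Let $\mathsf{FC}(\mathbf{S})$ be the inverse semigroup, under multiplication of subsets, of all order ideals $\{a_1,\ldots,a_m\}^{\downarrow}$ of $\mathbf{S}$ generated by non-empty finite pairwise compatible subsets. Define $\{a_1,\ldots,a_m\}^\downarrow\equiv\{b_1,\ldots,b_k\}^\downarrow$ iff $\{a_1,\ldots,a_m\}\leftrightarrow\{b_1,\ldots,b_k\}$ in $\mathbf{S}$, a congruence. Then $\mathsf{D}(S)=\mathsf{FC}(\mathbf{S})/\!\equiv$. $S$ is pre-Boolean if the idempotents of $\mathsf{D}(S)$ form a generalized Boolean algebra (distributive lattice with $0$ and relative complements, a top element not being required), and then $\mathsf{D}(S)$ is called the Boolean completion of $S$. $P_{n,r}$ is pre-Boolean and $C_{n,r}=\mathsf{D}(P_{n,r})$ is a monoid. Higman-Thompson group. Let $X$ be a set with $r$ elements and let $A^*$ act on the right on $X\times A^*$ by $(x,w)v=(x,wv)$. A subact is a subset closed under the action; it is finitely generated if it is a finite union of sets $pA^*$, and essential if it intersects every non-empty subact. The isomorphisms of right $A^*$-acts between finitely generated essential subacts form an inverse monoid under composition of partial maps, in which each element is a restriction of a unique maximal element. $G_{n,r}$ is the group whose elements are the maximal such isomorphisms, the product of $f$ and $g$ being the unique maximal isomorphism extending the composite $fg$ (equivalently, the maximum group image of this inverse monoid). *)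

theory Defs
  imports "HOL-Algebra.Group"
begin

section \<open>Semigroups with zero\<close>

record 'a semigroup0 = "'a partial_object" +
  smult :: "'a \<Rightarrow> 'a \<Rightarrow> 'a"  (infixl "\<cdot>\<index>" 70)
  szero :: "'a"

definition congruence :: "('a, 'z) semigroup0_scheme \<Rightarrow> ('a \<times> 'a) set \<Rightarrow> bool" where
  "congruence S \<rho> \<longleftrightarrow> equiv (carrier S) \<rho> \<and>
     (\<forall>s t u v. (s, t) \<in> \<rho> \<longrightarrow> (u, v) \<in> \<rho> \<longrightarrow> (s \<cdot>\<^bsub>S\<^esub> u, t \<cdot>\<^bsub>S\<^esub> v) \<in> \<rho>)"

definition generated_congruence ::
    "('a, 'z) semigroup0_scheme \<Rightarrow> ('a \<times> 'a) set \<Rightarrow> ('a \<times> 'a) set" where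
  "generated_congruence S R = \<Inter> {\<rho>. congruence S \<rho> \<and> R \<subseteq> \<rho>}"

text \<open>When \<open>\<rho>\<close> is a congruence, the union below is the single class of \<open>x y\<close>.\<close>

definition quotient_semigroup0 ::
    "('a, 'z) semigroup0_scheme \<Rightarrow> ('a \<times> 'a) set \<Rightarrow> 'a set semigroup0" where
  "quotient_semigroup0 S \<rho> =
     \<lparr>carrier = carrier S // \<rho>,
      smult = (\<lambda>U V. \<Union>x\<in>U. \<Union>y\<in>V. \<rho> `` {x \<cdot>\<^bsub>S\<^esub> y}),
      szero = \<rho> `` {szero S}\<rparr>"

definition idems :: "('a, 'z) semigroup0_scheme \<Rightarrow> 'a set" where
  "idems S = {e \<in> carrier S. e \<cdot>\<^bsub>S\<^esub> e = e}"

definition sinv :: "('a, 'z) semigroup0_scheme \<Rightarrow> 'a \<Rightarrow> 'a" where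
  "sinv S s = (THE t. t \<in> carrier S \<and> s \<cdot>\<^bsub>S\<^esub> t \<cdot>\<^bsub>S\<^esub> s = s \<and> t \<cdot>\<^bsub>S\<^esub> s \<cdot>\<^bsub>S\<^esub> t = t)"

definition nat_le :: "('a, 'z) semigroup0_scheme \<Rightarrow> 'a \<Rightarrow> 'a \<Rightarrow> bool" where
  "nat_le S s t \<longleftrightarrow> s \<in> carrier S \<and> t \<in> carrier S \<and> (\<exists>e\<in>idems S. s = t \<cdot>\<^bsub>S\<^esub> e)"

definition smeet :: "('a, 'z) semigroup0_scheme \<Rightarrow> 'a \<Rightarrow> 'a \<Rightarrow> 'a" where
  "smeet S s t = (THE m. nat_le S m s \<and> nat_le S m t \<and>
     (\<forall>x. nat_le S x s \<longrightarrow> nat_le S x t \<longrightarrow> nat_le S x m))"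

definition compatible :: "('a, 'z) semigroup0_scheme \<Rightarrow> 'a \<Rightarrow> 'a \<Rightarrow> bool" where
  "compatible S s t \<longleftrightarrow> sinv S s \<cdot>\<^bsub>S\<^esub> t \<in> idems S \<and> s \<cdot>\<^bsub>S\<^esub> sinv S t \<in> idems S"

text \<open>The monoid underlying a semigroup that possesses an identity.\<close>

definition monoid_of :: "('a, 'z) semigroup0_scheme \<Rightarrow> 'a monoid" where
  "monoid_of S = \<lparr>carrier = carrier S, mult = smult S,
     one = (THE e. e \<in> carrier S \<and> (\<forall>x\<in>carrier S. e \<cdot>\<^bsub>S\<^esub> x = x \<and> x \<cdot>\<^bsub>S\<^esub> e = x))\<rparr>"


section \<open>The distributive completion\<close>

text \<open>\<open>F \<rightarrow> H\<close> for finite sets of elements (Lenz).\<close>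

definition arrow :: "('a, 'z) semigroup0_scheme \<Rightarrow> 'a set \<Rightarrow> 'a set \<Rightarrow> bool" where
  "arrow S F H \<longleftrightarrow>
     (\<forall>a\<in>F. \<forall>x. nat_le S x a \<longrightarrow> x \<noteq> szero S \<longrightarrow> (\<exists>b\<in>H. smeet S x b \<noteq> szero S))"

definition lenz_equiv :: "('a, 'z) semigroup0_scheme \<Rightarrow> 'a set \<Rightarrow> 'a set \<Rightarrow> bool" where
  "lenz_equiv S F H \<longleftrightarrow> arrow S F H \<and> arrow S H F"

definition lenz_rel :: "('a, 'z) semigroup0_scheme \<Rightarrow> ('a \<times> 'a) set" where
  "lenz_rel S = {(s, t). s \<in> carrier S \<and> t \<in> carrier S \<and> lenz_equiv S {s} {t}}"

definition lenz_quotient :: "('a, 'z) semigroup0_scheme \<Rightarrow> 'a set semigroup0" where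
  "lenz_quotient S = quotient_semigroup0 S (lenz_rel S)"

definition down :: "('a, 'z) semigroup0_scheme \<Rightarrow> 'a set \<Rightarrow> 'a set" where
  "down S F = {x. \<exists>a\<in>F. nat_le S x a}"

definition compatible_sets :: "('a, 'z) semigroup0_scheme \<Rightarrow> 'a set set" where
  "compatible_sets S = {F. finite F \<and> F \<noteq> {} \<and> F \<subseteq> carrier S \<and>
     (\<forall>a\<in>F. \<forall>b\<in>F. compatible S a b)}"

definition FC :: "('a, 'z) semigroup0_scheme \<Rightarrow> 'a set semigroup0" where
  "FC S =
     \<lparr>carrier = down S ` compatible_sets S,
      smult = (\<lambda>I J. {x \<cdot>\<^bsub>S\<^esub> y | x y. x \<in> I \<and> y \<in> J}),
      szero = {szero S}\<rparr>"

text \<open>Whether \<open>arrow S F H\<close> holds depends only on \<open>down S F\<close> and \<open>down S H\<close>, so the choice of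
  generating sets is immaterial.\<close>

definition FC_rel :: "('a, 'z) semigroup0_scheme \<Rightarrow> ('a set \<times> 'a set) set" where
  "FC_rel S = {(down S F, down S H) | F H.
     F \<in> compatible_sets S \<and> H \<in> compatible_sets S \<and> lenz_equiv S F H}"

definition dist_completion :: "('a, 'z) semigroup0_scheme \<Rightarrow> 'a set set set semigroup0" where
  "dist_completion S = (let T = lenz_quotient S in quotient_semigroup0 (FC T) (FC_rel T))"


section \<open>Polycyclic monoids and extended polycyclic semigroups\<close>

text \<open>The free monoid with zero on \<open>X\<close>; \<open>None\<close> is the zero.\<close>

definition free_monoid0 :: "'g set \<Rightarrow> 'g list option semigroup0" where
  "free_monoid0 X =
     \<lparr>carrier = insert None (Some ` lists X),
      smult = (\<lambda>u v. case (u, v) of (Some x, Some y) \<Rightarrow> Some (x @ y) | _ \<Rightarrow> None),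
      szero = None\<rparr>"

definition presented_monoid0 ::
    "'g set \<Rightarrow> ('g list option \<times> 'g list option) set \<Rightarrow> 'g list option set semigroup0" where
  "presented_monoid0 X R =
     quotient_semigroup0 (free_monoid0 X) (generated_congruence (free_monoid0 X) R)"

datatype letter = Gen nat | GenInv nat

definition polycyclic :: "nat \<Rightarrow> letter list option set semigroup0" where
  "polycyclic n = presented_monoid0 (Gen ` {1..n} \<union> GenInv ` {1..n})
     ({(Some [GenInv i, Gen i], Some []) | i. i \<in> {1..n}} \<union>
      {(Some [GenInv i, Gen j], None) | i j. i \<in> {1..n} \<and> j \<in> {1..n} \<and> i \<noteq> j})"

text \<open>\<open>B\<^sub>r(M)\<close>; \<open>None\<close> is the zero.\<close>

definition brandt ::
    "nat \<Rightarrow> ('m, 'z) semigroup0_scheme \<Rightarrow> (nat \<times> 'm \<times> nat) option semigroup0" where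
  "brandt r M =
     \<lparr>carrier = insert None (Some ` ({1..r} \<times> (carrier M - {szero M}) \<times> {1..r})),
      smult = (\<lambda>s t. case (s, t) of
          (Some (i, m, j), Some (k, p, l)) \<Rightarrow>
            if j = k \<and> m \<cdot>\<^bsub>M\<^esub> p \<noteq> szero M then Some (i, m \<cdot>\<^bsub>M\<^esub> p, l) else None
        | _ \<Rightarrow> None),
      szero = None\<rparr>"

definition ext_polycyclic ::
    "nat \<Rightarrow> nat \<Rightarrow> (nat \<times> letter list option set \<times> nat) option semigroup0" where
  "ext_polycyclic n r = brandt r (polycyclic n)"

definition cuntz_monoid ::
    "nat \<Rightarrow> nat \<Rightarrow> (nat \<times> letter list option set \<times> nat) option set set set monoid" where
  "cuntz_monoid n r = monoid_of (dist_completion (ext_polycyclic n r))"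


section \<open>Higman--Thompson groups\<close>

definition ract :: "'x \<times> 'a list \<Rightarrow> 'a list \<Rightarrow> 'x \<times> 'a list" where
  "ract p v = (fst p, snd p @ v)"

definition subact :: "'x set \<Rightarrow> 'a set \<Rightarrow> ('x \<times> 'a list) set \<Rightarrow> bool" where
  "subact X A Y \<longleftrightarrow> Y \<subseteq> X \<times> lists A \<and> (\<forall>p\<in>Y. \<forall>v\<in>lists A. ract p v \<in> Y)"

definition fg_subact :: "'x set \<Rightarrow> 'a set \<Rightarrow> ('x \<times> 'a list) set \<Rightarrow> bool" where
  "fg_subact X A Y \<longleftrightarrow>
     (\<exists>F. finite F \<and> F \<subseteq> X \<times> lists A \<and> Y = (\<Union>p\<in>F. ract p ` lists A))"

definition essential_subact :: "'x set \<Rightarrow> 'a set \<Rightarrow> ('x \<times> 'a list) set \<Rightarrow> bool" where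
  "essential_subact X A Y \<longleftrightarrow>
     subact X A Y \<and> (\<forall>Z. subact X A Z \<longrightarrow> Z \<noteq> {} \<longrightarrow> Y \<inter> Z \<noteq> {})"

definition ess_isos ::
    "'x set \<Rightarrow> 'a set \<Rightarrow> ('x \<times> 'a list \<rightharpoonup> 'x \<times> 'a list) set" where
  "ess_isos X A = {f.
     fg_subact X A (dom f) \<and> essential_subact X A (dom f) \<and>
     fg_subact X A (ran f) \<and> essential_subact X A (ran f) \<and>
     inj_on f (dom f) \<and>
     (\<forall>p\<in>dom f. \<forall>v\<in>lists A. f (ract p v) = map_option (\<lambda>q. ract q v) (f p))}"

definition max_ess_isos ::
    "'x set \<Rightarrow> 'a set \<Rightarrow> ('x \<times> 'a list \<rightharpoonup> 'x \<times> 'a list) set" where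
  "max_ess_isos X A = {f \<in> ess_isos X A. \<forall>g\<in>ess_isos X A. f \<subseteq>\<^sub>m g \<longrightarrow> g = f}"

text \<open>The operation is not composition itself: a composite of maximal isomorphisms need not be
  maximal, and is replaced by its maximal extension.\<close>

definition act_HT_group ::
    "'x set \<Rightarrow> 'a set \<Rightarrow> ('x \<times> 'a list \<rightharpoonup> 'x \<times> 'a list) monoid" where
  "act_HT_group X A =
     \<lparr>carrier = max_ess_isos X A,
      mult = (\<lambda>f g. THE h. h \<in> max_ess_isos X A \<and> f \<circ>\<^sub>m g \<subseteq>\<^sub>m h),
      one = Some |` (X \<times> lists A)\<rparr>"

definition higman_thompson ::
    "nat \<Rightarrow> nat \<Rightarrow> (nat \<times> nat list \<rightharpoonup> nat \<times> nat list) monoid" where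
  "higman_thompson n r = act_HT_group {1..r} {1..n}"

end

theory Submission
  imports Defs
begin

text \<open>
  Sending \<open>(i, y x\<^sup>-\<^sup>1, j)\<close> to the relation \<open>{((i, y w), (j, x w)) | w}\<close> represents
  \<open>P\<^sub>n\<^sub>,\<^sub>r\<close> faithfully by partial bijections of the free act \<open>X \<times> A\<^sup>*\<close>. Under this
  representation the natural partial order is inclusion, meets are intersections and \<open>\<leftrightarrow>\<close> is
  trivial on elements (this uses \<open>n \<ge> 2\<close>), so an element of \<open>FC\<close> becomes the union \<open>f\<close> of a
  finite compatible family, i.e. an isomorphism between finitely generated subacts, and \<open>f \<equiv> g\<close>
  says that every point \<open>p\<close> in the domain of either relation has an extension \<open>p v\<close> on which both
  are defined and agree. The class of \<open>f\<close> is a unit iff the domain and range of \<open>f\<close> are essential.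
  Such an \<open>f\<close> has a largest equivalent \<open>{(q, p). \<forall>v. \<exists>w. (q v w, p v w) \<in> f}\<close>, whose domain is
  finitely generated because an essential finitely generated subact is cofinite; hence each unit
  contains exactly one maximal isomorphism.\<close>

section \<open>Inverse semigroups of partial bijections\<close>

text \<open>\<open>dist_completion\<close> consists of sets of sets of sets, and inverses, meets and
  the identity are given by definite descriptions, so little of it can be computed with directly. An
  injective representation removes both difficulties: each description is resolved by an explicit
  relation, and each class is handled through a relation that determines it. Pairs are written
  (value, argument), so that \<open>O\<close> keeps the order of the semigroup product and of
  composition of partial maps. On the algebraic side the representation also shows that the
  presentation does not collapse: distinct normal forms act differently on words. The two letters
  enter through separation: over a one-letter alphabet every \<open>basic\<close> relation would be
  equivalent to each of its nonempty restrictions, whereas a second letter yields an extension that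
  leaves the restriction for good. Since \<leftrightarrow> is then equality, passing to its quotient
  keeps the family of relations, and the same locale serves before and after it.\<close>

definition biunique :: "('p \<times> 'p) set \<Rightarrow> bool" where
  "biunique f \<longleftrightarrow> single_valued f \<and> single_valued (f\<inverse>)"

lemma biunique_right: "biunique f \<Longrightarrow> (q, p) \<in> f \<Longrightarrow> (q, p') \<in> f \<Longrightarrow> p = p'"
  and biunique_left: "biunique f \<Longrightarrow> (q, p) \<in> f \<Longrightarrow> (q', p) \<in> f \<Longrightarrow> q = q'"
  unfolding biunique_def single_valued_def by auto

lemma biuniqueI:
  assumes "\<And>q p p'. (q, p) \<in> f \<Longrightarrow> (q, p') \<in> f \<Longrightarrow> p = p'"
    and "\<And>q q' p. (q, p) \<in> f \<Longrightarrow> (q', p) \<in> f \<Longrightarrow> q = q'"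
  shows "biunique f"
  using assms unfolding biunique_def single_valued_def by auto

lemma biunique_subset: "biunique g \<Longrightarrow> f \<subseteq> g \<Longrightarrow> biunique f"
  unfolding biunique_def by (meson converse_mono single_valued_subset)

lemma biunique_comp: "biunique f \<Longrightarrow> biunique g \<Longrightarrow> biunique (f O g)"
  by (simp add: biunique_def converse_relcomp single_valued_relcomp)

lemma biunique_converse: "biunique f \<Longrightarrow> biunique (f\<inverse>)"
  by (simp add: biunique_def)

text \<open>Two-sided uniqueness pins the intermediate point: if \<open>(q, m)\<close> and
  \<open>(m, p)\<close> lie in \<open>f\<close> next to \<open>(q, p)\<close>, then m equals p by
  the first pair and q by the second.\<close>

lemma biunique_idempotent_iff:
  assumes "biunique f"
  shows "f O f = f \<longleftrightarrow> f \<subseteq> Id"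
proof
  assume idem: "f O f = f"
  show "f \<subseteq> Id"
  proof (rule subrelI)
    fix q p assume qp: "(q, p) \<in> f"
    then obtain m where m: "(q, m) \<in> f" "(m, p) \<in> f"
      using idem by blast
    then show "(q, p) \<in> Id"
      using qp assms by (metis IdI biunique_left biunique_right)
  qed
qed blast

text \<open>Needed to resolve \<open>sinv\<close>. A pair \<open>(q, p)\<close> of \<open>g\<close>
  can pass through \<open>g O h O g\<close> only along q, p, q, p, so \<open>(p, q)\<close> lies in
  \<open>h\<close>. Used for \<open>f\<close> and for \<open>t\<close>, this gives the two
  inclusions.\<close>

lemma biunique_inverse_unique:
  assumes f: "biunique f" and t: "biunique t"
    and ftf: "f O t O f = f" and tft: "t O f O t = t"
  shows "t = f\<inverse>"
proof -
  have sub: "g\<inverse> \<subseteq> h" if g: "biunique g" and ghg: "g O h O g = g" for g h :: "('a \<times> 'a) set"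
  proof (rule subrelI)
    fix p q assume "(p, q) \<in> g\<inverse>"
    then have qp: "(q, p) \<in> g" by simp
    then obtain p' q' where "(q, p') \<in> g" "(p', q') \<in> h" "(q', p) \<in> g"
      using ghg by blast
    then show "(p, q) \<in> h"
      using qp g by (metis biunique_left biunique_right)
  qed
  show ?thesis
    using sub[OF f ftf] sub[OF t tft] by auto
qed

lemma biunique_comp_converse_comp:
  assumes "biunique f"
  shows "f O f\<inverse> O f = f"
proof (intro equalityI subrelI)
  fix q p assume "(q, p) \<in> f O f\<inverse> O f"
  then obtain m q' where "(q, m) \<in> f" "(q', m) \<in> f" "(q', p) \<in> f" by blast
  then show "(q, p) \<in> f"
    using assms by (metis biunique_left)
qed blast

text \<open>\<open>s\<inverse> O s\<close> is the identity on the arguments of \<open>s\<close>, so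
  the composite cuts \<open>t\<close> down to them. The idempotent required by the natural partial
  order comes from here.\<close>

lemma restriction_eq_comp:
  assumes "biunique t" "s \<subseteq> t"
  shows "s = t O s\<inverse> O s"
proof -
  have "biunique s" using assms biunique_subset by blast
  show ?thesis
  proof (intro equalityI subrelI)
    fix q p assume "(q, p) \<in> s"
    then show "(q, p) \<in> t O s\<inverse> O s" using assms by auto
  next
    fix q p assume "(q, p) \<in> t O s\<inverse> O s"
    then obtain m q' where "(q, m) \<in> t" "(q', m) \<in> s" "(q', p) \<in> s" by auto
    then show "(q, p) \<in> s"
      using assms \<open>biunique s\<close> by (metis biunique_left subsetD)
  qed
qed

section \<open>Semigroups represented by partial bijections\<close>

definition partial_unions :: "('p \<times> 'p) set set \<Rightarrow> ('p \<times> 'p) set set" where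
  "partial_unions B = {\<Union>K | K. finite K \<and> K \<subseteq> B \<and> biunique (\<Union>K)}"

text \<open>Lenz's arrow read off the underlying relations: non-zero elements become nonempty
  members of \<open>B\<close>, and a non-zero meet becomes a nonempty intersection.\<close>

definition dense_in :: "('p \<times> 'p) set set \<Rightarrow> ('p \<times> 'p) set \<Rightarrow> ('p \<times> 'p) set \<Rightarrow> bool" where
  "dense_in B f g \<longleftrightarrow> (\<forall>x\<in>B. x \<noteq> {} \<longrightarrow> x \<subseteq> f \<longrightarrow> x \<inter> g \<noteq> {})"

text \<open>Kept apart from \<open>relation_rep\<close> because the quotient and Brandt
  constructions only transport multiplicativity and injectivity; the image is matched with a family
  of partial bijections once the extended semigroup is reached.\<close>

locale faithful_rep =
  fixes S :: "('s, 'z) semigroup0_scheme" (structure)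
    and \<theta> :: "'s \<Rightarrow> ('p \<times> 'p) set"
  assumes inj: "inj_on \<theta> (carrier S)"
    and mult_closed: "\<lbrakk>s \<in> carrier S; t \<in> carrier S\<rbrakk> \<Longrightarrow> s \<cdot> t \<in> carrier S"
    and rep_mult: "\<lbrakk>s \<in> carrier S; t \<in> carrier S\<rbrakk> \<Longrightarrow> \<theta> (s \<cdot> t) = \<theta> s O \<theta> t"
    and zero_closed: "szero S \<in> carrier S"
    and rep_zero: "\<theta> (szero S) = {}"
begin

lemma rep_eq_iff: "\<lbrakk>s \<in> carrier S; t \<in> carrier S\<rbrakk> \<Longrightarrow> \<theta> s = \<theta> t \<longleftrightarrow> s = t"
  using inj by (simp add: inj_on_eq_iff)

lemma rep_empty_iff: "s \<in> carrier S \<Longrightarrow> \<theta> s = {} \<longleftrightarrow> s = szero S"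
  using rep_eq_iff[OF _ zero_closed] rep_zero by simp

end

text \<open>Closure under converse and intersection supplies inverses and meets. \<open>B\<close> is
  a parameter of its own so that a semigroup and its quotient can share it.\<close>

locale relation_rep = faithful_rep S \<theta>
  for S :: "('s, 'z) semigroup0_scheme" (structure) and \<theta> :: "'s \<Rightarrow> ('p \<times> 'p) set" +
  fixes B :: "('p \<times> 'p) set set"
  assumes image: "\<theta> ` carrier S = B"
    and biunique: "f \<in> B \<Longrightarrow> biunique f"
    and converse: "f \<in> B \<Longrightarrow> f\<inverse> \<in> B"
    and inter: "\<lbrakk>f \<in> B; g \<in> B\<rbrakk> \<Longrightarrow> f \<inter> g \<in> B"
begin

lemma rep_in: "s \<in> carrier S \<Longrightarrow> \<theta> s \<in> B"
  using image by blast

lemma rep_biunique: "s \<in> carrier S \<Longrightarrow> biunique (\<theta> s)"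
  using rep_in biunique by blast

lemma rep_obtain:
  assumes "f \<in> B"
  obtains s where "s \<in> carrier S" "\<theta> s = f"
  using assms image by blast

lemma comp_in:
  assumes "f \<in> B" "g \<in> B"
  shows "f O g \<in> B"
proof -
  obtain s t where "s \<in> carrier S" "\<theta> s = f" "t \<in> carrier S" "\<theta> t = g"
    using assms rep_obtain by metis
  then show ?thesis using rep_in[OF mult_closed[of s t]] by (simp add: rep_mult)
qed

lemma idems_iff: "e \<in> idems S \<longleftrightarrow> e \<in> carrier S \<and> \<theta> e \<subseteq> Id"
proof (cases "e \<in> carrier S")
  case True
  then have "e \<cdot> e = e \<longleftrightarrow> \<theta> e O \<theta> e = \<theta> e"
    by (metis mult_closed rep_eq_iff rep_mult)
  then show ?thesis
    using True biunique_idempotent_iff[OF rep_biunique[OF True]] by (simp add: idems_def)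
qed (simp add: idems_def)

lemma sinv:
  assumes s: "s \<in> carrier S"
  shows "sinv S s \<in> carrier S \<and> \<theta> (sinv S s) = (\<theta> s)\<inverse>"
proof -
  obtain t where t: "t \<in> carrier S" "\<theta> t = (\<theta> s)\<inverse>"
    using rep_obtain converse rep_in s by metis
  have "sinv S s = t"
    unfolding sinv_def
  proof (rule the_equality)
    have "\<theta> (s \<cdot> t \<cdot> s) = \<theta> s" "\<theta> (t \<cdot> s \<cdot> t) = \<theta> t"
      using biunique_comp_converse_comp[OF rep_biunique[OF s]]
        biunique_comp_converse_comp[OF rep_biunique[OF t(1)]]
      by (simp_all add: s t mult_closed rep_mult O_assoc)
    then show "t \<in> carrier S \<and> s \<cdot> t \<cdot> s = s \<and> t \<cdot> s \<cdot> t = t"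
      using t(1) rep_eq_iff[OF mult_closed[OF mult_closed[OF s t(1)] s] s]
        rep_eq_iff[OF mult_closed[OF mult_closed[OF t(1) s] t(1)] t(1)] by blast
  next
    fix u assume u: "u \<in> carrier S \<and> s \<cdot> u \<cdot> s = s \<and> u \<cdot> s \<cdot> u = u"
    then have "\<theta> s O \<theta> u O \<theta> s = \<theta> s" "\<theta> u O \<theta> s O \<theta> u = \<theta> u"
      using s mult_closed rep_mult[of "s \<cdot> u" s] rep_mult[of "u \<cdot> s" u] rep_mult[of s u]
        rep_mult[of u s] by (simp_all add: O_assoc)
    then have "\<theta> u = (\<theta> s)\<inverse>"
      using biunique_inverse_unique rep_biunique s u by metis
    then show "u = t" using u t rep_eq_iff by metis
  qed
  with t show ?thesis by simp
qed

lemma nat_le_iff: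
  "nat_le S s t \<longleftrightarrow> s \<in> carrier S \<and> t \<in> carrier S \<and> \<theta> s \<subseteq> \<theta> t"
proof (cases "s \<in> carrier S \<and> t \<in> carrier S")
  case True
  have "\<exists>e\<in>idems S. s = t \<cdot> e" if sub: "\<theta> s \<subseteq> \<theta> t"
  proof -
    \<comment> \<open>The idempotent sought is the identity on the arguments of
      \<open>\<theta> s\<close>.\<close>
    obtain e where e: "e \<in> carrier S" "\<theta> e = (\<theta> s)\<inverse> O \<theta> s"
      using rep_obtain comp_in converse rep_in True by metis
    have "\<theta> e \<subseteq> Id"
      using biunique_right[OF rep_biunique] True e by fastforce
    moreover have "\<theta> (t \<cdot> e) = \<theta> s"
      using restriction_eq_comp[OF rep_biunique sub] True e by (simp add: rep_mult)
    ultimately show ?thesis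
      using e True idems_iff mult_closed rep_eq_iff by metis
  qed
  moreover have "\<theta> s \<subseteq> \<theta> t" if "e \<in> idems S" "s = t \<cdot> e" for e
    using that True by (auto simp: idems_iff rep_mult)
  ultimately show ?thesis
    using True unfolding nat_le_def by blast
qed (auto simp: nat_le_def)

lemma smeet:
  assumes s: "s \<in> carrier S" and t: "t \<in> carrier S"
  shows "smeet S s t \<in> carrier S \<and> \<theta> (smeet S s t) = \<theta> s \<inter> \<theta> t"
proof -
  obtain m where m: "m \<in> carrier S" "\<theta> m = \<theta> s \<inter> \<theta> t"
    using rep_obtain inter rep_in s t by metis
  have "smeet S s t = m"
    unfolding smeet_def
  proof (rule the_equality)
    fix u assume u: "nat_le S u s \<and> nat_le S u t \<and>
      (\<forall>x. nat_le S x s \<longrightarrow> nat_le S x t \<longrightarrow> nat_le S x u)"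
    then have "\<theta> u \<subseteq> \<theta> m" "\<theta> m \<subseteq> \<theta> u" "u \<in> carrier S"
      using m s t unfolding nat_le_iff by blast+
    then show "u = m" using m rep_eq_iff by blast
  qed (use m s t in \<open>auto simp: nat_le_iff\<close>)
  with m show ?thesis by simp
qed

text \<open>The two idempotency conditions are the mixed cases of two-sided uniqueness, one pair
  from each relation; the unmixed cases hold because each relation is \<open>biunique\<close> by
  itself.\<close>

lemma compatible_iff:
  assumes s: "s \<in> carrier S" and t: "t \<in> carrier S"
  shows "compatible S s t \<longleftrightarrow> biunique (\<theta> s \<union> \<theta> t)"
proof -
  have "compatible S s t \<longleftrightarrow> (\<theta> s)\<inverse> O \<theta> t \<subseteq> Id \<and> \<theta> s O (\<theta> t)\<inverse> \<subseteq> Id"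
    unfolding compatible_def using s t sinv by (simp add: idems_iff rep_mult mult_closed)
  also have "\<dots> \<longleftrightarrow> biunique (\<theta> s \<union> \<theta> t)"
  proof
    assume "(\<theta> s)\<inverse> O \<theta> t \<subseteq> Id \<and> \<theta> s O (\<theta> t)\<inverse> \<subseteq> Id"
    then show "biunique (\<theta> s \<union> \<theta> t)"
      using biunique_left[OF rep_biunique[OF s]] biunique_left[OF rep_biunique[OF t]]
        biunique_right[OF rep_biunique[OF s]] biunique_right[OF rep_biunique[OF t]]
      by (intro biuniqueI) blast+
  next
    assume "biunique (\<theta> s \<union> \<theta> t)"
    then show "(\<theta> s)\<inverse> O \<theta> t \<subseteq> Id \<and> \<theta> s O (\<theta> t)\<inverse> \<subseteq> Id"
      using biunique_left[of "\<theta> s \<union> \<theta> t"] biunique_right[of "\<theta> s \<union> \<theta> t"] by blast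
  qed
  finally show ?thesis .
qed

text \<open>A failure of two-sided uniqueness involves only two pairs, hence at most two members of
  \<open>F\<close>, so the pairwise condition is already the condition on the whole union.\<close>

lemma compatible_sets_iff:
  "F \<in> compatible_sets S \<longleftrightarrow>
     finite F \<and> F \<noteq> {} \<and> F \<subseteq> carrier S \<and> biunique (\<Union>(\<theta> ` F))"
proof (cases "F \<subseteq> carrier S")
  case True
  then have "(\<forall>a\<in>F. \<forall>b\<in>F. compatible S a b) \<longleftrightarrow> (\<forall>a\<in>F. \<forall>b\<in>F. biunique (\<theta> a \<union> \<theta> b))"
    using compatible_iff by (meson subsetD)
  also have "\<dots> \<longleftrightarrow> biunique (\<Union>(\<theta> ` F))"
  proof
    assume F: "\<forall>a\<in>F. \<forall>b\<in>F. biunique (\<theta> a \<union> \<theta> b)"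
    show "biunique (\<Union>(\<theta> ` F))"
    proof (rule biuniqueI)
      fix q p p' assume "(q, p) \<in> \<Union>(\<theta> ` F)" "(q, p') \<in> \<Union>(\<theta> ` F)"
      then obtain a b where "a \<in> F" "b \<in> F" "(q, p) \<in> \<theta> a" "(q, p') \<in> \<theta> b" by blast
      then show "p = p'" using F by (meson UnI1 UnI2 biunique_right)
    next
      fix q q' p assume "(q, p) \<in> \<Union>(\<theta> ` F)" "(q', p) \<in> \<Union>(\<theta> ` F)"
      then obtain a b where "a \<in> F" "b \<in> F" "(q, p) \<in> \<theta> a" "(q', p) \<in> \<theta> b" by blast
      then show "q = q'" using F by (meson UnI1 UnI2 biunique_left)
    qed
  next
    assume *: "biunique (\<Union>(\<theta> ` F))"
    show "\<forall>a\<in>F. \<forall>b\<in>F. biunique (\<theta> a \<union> \<theta> b)"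
      by (intro ballI biunique_subset[OF *]) auto
  qed
  finally show ?thesis using True by (auto simp: compatible_sets_def)
qed (auto simp: compatible_sets_def)

text \<open>A test relation inside the union need not lie inside one member, but it meets some
  \<open>\<theta> a\<close>, and that intersection is again a test relation, now below a single
  generator.\<close>

lemma dense_in_Union_iff:
  assumes "F \<subseteq> carrier S"
  shows "dense_in B (\<Union>(\<theta> ` F)) g \<longleftrightarrow>
    (\<forall>a\<in>F. \<forall>x\<in>B. x \<subseteq> \<theta> a \<longrightarrow> x \<noteq> {} \<longrightarrow> x \<inter> g \<noteq> {})"
proof
  assume F: "\<forall>a\<in>F. \<forall>x\<in>B. x \<subseteq> \<theta> a \<longrightarrow> x \<noteq> {} \<longrightarrow> x \<inter> g \<noteq> {}"
  show "dense_in B (\<Union>(\<theta> ` F)) g"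
    unfolding dense_in_def
  proof (intro ballI impI)
    fix x assume x: "x \<in> B" "x \<noteq> {}" "x \<subseteq> \<Union>(\<theta> ` F)"
    then obtain a where a: "a \<in> F" "x \<inter> \<theta> a \<noteq> {}" by blast
    have "x \<inter> \<theta> a \<in> B" using a assms inter rep_in x by blast
    then have "x \<inter> \<theta> a \<inter> g \<noteq> {}" using F a by blast
    then show "x \<inter> g \<noteq> {}" by blast
  qed
next
  assume D: "dense_in B (\<Union>(\<theta> ` F)) g"
  show "\<forall>a\<in>F. \<forall>x\<in>B. x \<subseteq> \<theta> a \<longrightarrow> x \<noteq> {} \<longrightarrow> x \<inter> g \<noteq> {}"
  proof (intro ballI impI)
    fix a x assume "a \<in> F" "x \<in> B" "x \<subseteq> \<theta> a" "x \<noteq> {}"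
    then show "x \<inter> g \<noteq> {}" using D unfolding dense_in_def by (meson UN_upper order_trans)
  qed
qed

lemma arrow_iff:
  assumes F: "F \<subseteq> carrier S" and H: "H \<subseteq> carrier S"
  shows "arrow S F H \<longleftrightarrow> dense_in B (\<Union>(\<theta> ` F)) (\<Union>(\<theta> ` H))"
proof -
  have meet: "smeet S x b \<noteq> szero S \<longleftrightarrow> \<theta> x \<inter> \<theta> b \<noteq> {}"
    if "x \<in> carrier S" "b \<in> H" for x b
    using that H smeet[of x b] rep_empty_iff[of "smeet S x b"] by auto
  have "arrow S F H \<longleftrightarrow> (\<forall>a\<in>F. \<forall>x\<in>carrier S. \<theta> x \<subseteq> \<theta> a \<longrightarrow> \<theta> x \<noteq> {} \<longrightarrow>
      \<theta> x \<inter> \<Union>(\<theta> ` H) \<noteq> {})"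
    using F meet unfolding arrow_def nat_le_iff by (auto simp: rep_empty_iff) blast+
  also have "\<dots> \<longleftrightarrow> (\<forall>a\<in>F. \<forall>x\<in>B. x \<subseteq> \<theta> a \<longrightarrow> x \<noteq> {} \<longrightarrow> x \<inter> \<Union>(\<theta> ` H) \<noteq> {})"
    using image by blast
  finally show ?thesis using dense_in_Union_iff[OF F] by simp
qed

section \<open>Ideals generated by compatible families\<close>

lemma Union_down:
  assumes "F \<subseteq> carrier S"
  shows "\<Union>(\<theta> ` down S F) = \<Union>(\<theta> ` F)"
proof
  show "\<Union>(\<theta> ` down S F) \<subseteq> \<Union>(\<theta> ` F)"
    by (auto simp: down_def nat_le_iff)
  have "F \<subseteq> down S F"
    using assms by (auto simp: down_def nat_le_iff)
  then show "\<Union>(\<theta> ` F) \<subseteq> \<Union>(\<theta> ` down S F)" by blast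
qed

lemma FC_carrierE:
  assumes "I \<in> carrier (FC S)"
  obtains F where "F \<in> compatible_sets S" "F \<subseteq> carrier S" "I = down S F"
    "\<Union>(\<theta> ` I) = \<Union>(\<theta> ` F)"
proof -
  have "I \<in> down S ` compatible_sets S"
    using assms by (simp add: FC_def)
  then obtain F where F: "F \<in> compatible_sets S" "I = down S F"
    by (rule imageE)
  then have "F \<subseteq> carrier S" by (simp add: compatible_sets_iff)
  with F show thesis using that[of F] Union_down[of F] by simp
qed

lemma FC_Union_image: "(\<lambda>I. \<Union>(\<theta> ` I)) ` carrier (FC S) = partial_unions B"
proof (intro equalityI subsetI)
  fix f assume "f \<in> (\<lambda>I. \<Union>(\<theta> ` I)) ` carrier (FC S)"
  then obtain I where "I \<in> carrier (FC S)" "f = \<Union>(\<theta> ` I)" by blast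
  then obtain F where F: "F \<in> compatible_sets S" "f = \<Union>(\<theta> ` F)"
    by (metis FC_carrierE)
  moreover have "finite (\<theta> ` F)" "\<theta> ` F \<subseteq> B" "biunique f"
    using F rep_in by (auto simp: compatible_sets_iff)
  ultimately show "f \<in> partial_unions B"
    unfolding partial_unions_def by blast
next
  fix f assume "f \<in> partial_unions B"
  then obtain K where K: "finite K" "K \<subseteq> B" "biunique f" "f = \<Union>K"
    unfolding partial_unions_def by blast
  then obtain F where F: "F \<subseteq> carrier S" "finite F" "\<theta> ` F = K"
    using image by (metis finite_subset_image)
  \<comment> \<open>Generating sets must be nonempty while \<open>K\<close> may be empty; the zero
    adds only the empty relation to the union.\<close>
  let ?F = "insert (szero S) F"
  have U: "\<Union>(\<theta> ` ?F) = f" using F K rep_zero by simp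
  have *: "?F \<in> compatible_sets S"
    using F K U zero_closed by (simp add: compatible_sets_iff)
  then have "\<Union>(\<theta> ` down S ?F) = f"
    using Union_down[of ?F] U by (simp add: compatible_sets_iff)
  moreover have "down S ?F \<in> carrier (FC S)"
    using * by (simp add: FC_def)
  ultimately show "f \<in> (\<lambda>I. \<Union>(\<theta> ` I)) ` carrier (FC S)" by blast
qed

text \<open>The elementwise product of two ideals is generated by the products of their generators:
  an element below \<open>a \<cdot> b\<close> is \<open>a \<cdot> b \<cdot> e\<close>, and the
  idempotent can be absorbed into the second factor, which stays below \<open>b\<close>.\<close>

lemma FC_mult:
  assumes I: "I \<in> carrier (FC S)" and J: "J \<in> carrier (FC S)"
  shows "I \<cdot>\<^bsub>FC S\<^esub> J \<in> carrier (FC S)"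
    and "\<Union>(\<theta> ` (I \<cdot>\<^bsub>FC S\<^esub> J)) = \<Union>(\<theta> ` I) O \<Union>(\<theta> ` J)"
proof -
  obtain F where F: "F \<in> compatible_sets S" "F \<subseteq> carrier S" "I = down S F"
    "\<Union>(\<theta> ` I) = \<Union>(\<theta> ` F)" using FC_carrierE[OF I] .
  obtain H where H: "H \<in> compatible_sets S" "H \<subseteq> carrier S" "J = down S H"
    "\<Union>(\<theta> ` J) = \<Union>(\<theta> ` H)" using FC_carrierE[OF J] .
  define L where "L = (\<lambda>(a, b). a \<cdot> b) ` (F \<times> H)"
  have L: "finite L" "L \<noteq> {}"
    using F(1) H(1) by (simp_all add: L_def compatible_sets_iff)
  have L_carrier: "L \<subseteq> carrier S"
  proof
    fix z assume "z \<in> L"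
    then obtain a b where "a \<in> F" "b \<in> H" "z = a \<cdot> b" by (auto simp: L_def)
    then show "z \<in> carrier S" using F(2) H(2) mult_closed by blast
  qed
  have U: "\<Union>(\<theta> ` L) = \<Union>(\<theta> ` F) O \<Union>(\<theta> ` H)"
  proof -
    have "\<Union>(\<theta> ` L) = (\<Union>a\<in>F. \<Union>b\<in>H. \<theta> (a \<cdot> b))" by (auto simp: L_def)
    also have "\<dots> = (\<Union>a\<in>F. \<Union>b\<in>H. \<theta> a O \<theta> b)"
      using F(2) H(2) by (intro SUP_cong refl rep_mult) auto
    also have "\<dots> = \<Union>(\<theta> ` F) O \<Union>(\<theta> ` H)"
      by (simp add: relcomp_UNION_distrib relcomp_UNION_distrib2) (rule SUP_commute)
    finally show ?thesis .
  qed
  have Lc: "L \<in> compatible_sets S"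
    using L L_carrier F(1) H(1) biunique_comp unfolding compatible_sets_iff U by blast
  have IJ: "I \<cdot>\<^bsub>FC S\<^esub> J = down S L"
  proof (intro equalityI subsetI)
    fix z assume "z \<in> I \<cdot>\<^bsub>FC S\<^esub> J"
    then obtain x y a b where z: "z = x \<cdot> y" "a \<in> F" "b \<in> H" "nat_le S x a" "nat_le S y b"
      using F(3) H(3) by (auto simp: FC_def down_def)
    then have "nat_le S z (a \<cdot> b)"
      by (auto simp: nat_le_iff mult_closed rep_mult)
    then show "z \<in> down S L" using z by (auto simp: down_def L_def)
  next
    fix z assume "z \<in> down S L"
    then obtain a b where ab: "a \<in> F" "b \<in> H" "nat_le S z (a \<cdot> b)"
      by (auto simp: down_def L_def)
    have abc: "a \<in> carrier S" "b \<in> carrier S" using ab F H by auto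
    obtain e where e: "e \<in> idems S" "z = a \<cdot> b \<cdot> e" "z \<in> carrier S"
      using ab by (auto simp: nat_le_def)
    then have "e \<in> carrier S" by (simp add: idems_def)
    \<comment> \<open>Associativity in \<open>S\<close> is pulled back from that of \<open>O\<close>
      along the injection.\<close>
    then have "\<theta> (a \<cdot> b \<cdot> e) = \<theta> (a \<cdot> (b \<cdot> e))"
      using abc mult_closed by (simp add: rep_mult O_assoc)
    then have z: "z = a \<cdot> (b \<cdot> e)"
      using e abc \<open>e \<in> carrier S\<close> mult_closed rep_eq_iff by metis
    have "nat_le S (b \<cdot> e) b"
      using e abc \<open>e \<in> carrier S\<close> mult_closed by (auto simp: nat_le_def)
    moreover have "nat_le S a a" using abc by (simp add: nat_le_iff)
    ultimately show "z \<in> I \<cdot>\<^bsub>FC S\<^esub> J"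
      using z ab F(3) H(3) by (auto simp: FC_def down_def)
  qed
  show "I \<cdot>\<^bsub>FC S\<^esub> J \<in> carrier (FC S)"
    using IJ Lc by (simp add: FC_def)
  show "\<Union>(\<theta> ` (I \<cdot>\<^bsub>FC S\<^esub> J)) = \<Union>(\<theta> ` I) O \<Union>(\<theta> ` J)"
    using IJ Union_down[OF L_carrier] U F(4) H(4) by simp
qed

lemma FC_rel_iff:
  "(I, J) \<in> FC_rel S \<longleftrightarrow> I \<in> carrier (FC S) \<and> J \<in> carrier (FC S) \<and>
     dense_in B (\<Union>(\<theta> ` I)) (\<Union>(\<theta> ` J)) \<and> dense_in B (\<Union>(\<theta> ` J)) (\<Union>(\<theta> ` I))"
proof -
  have *: "lenz_equiv S F H \<longleftrightarrow>
     dense_in B (\<Union>(\<theta> ` down S F)) (\<Union>(\<theta> ` down S H)) \<and>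
     dense_in B (\<Union>(\<theta> ` down S H)) (\<Union>(\<theta> ` down S F))"
    if "F \<in> compatible_sets S" "H \<in> compatible_sets S" for F H
    using that by (simp add: lenz_equiv_def arrow_iff Union_down compatible_sets_iff)
  show ?thesis
  proof
    assume "(I, J) \<in> FC_rel S"
    then obtain F H where "I = down S F" "J = down S H" "F \<in> compatible_sets S"
      "H \<in> compatible_sets S" "lenz_equiv S F H"
      unfolding FC_rel_def by blast
    then show "I \<in> carrier (FC S) \<and> J \<in> carrier (FC S) \<and>
     dense_in B (\<Union>(\<theta> ` I)) (\<Union>(\<theta> ` J)) \<and> dense_in B (\<Union>(\<theta> ` J)) (\<Union>(\<theta> ` I))"
      using * by (simp add: FC_def)
  next
    assume IJ: "I \<in> carrier (FC S) \<and> J \<in> carrier (FC S) \<and>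
     dense_in B (\<Union>(\<theta> ` I)) (\<Union>(\<theta> ` J)) \<and> dense_in B (\<Union>(\<theta> ` J)) (\<Union>(\<theta> ` I))"
    then obtain F H where "F \<in> compatible_sets S" "I = down S F"
      "H \<in> compatible_sets S" "J = down S H"
      by (auto simp: FC_def)
    with IJ * show "(I, J) \<in> FC_rel S"
      unfolding FC_rel_def by blast
  qed
qed

end

section \<open>Density and the distributive completion\<close>

definition codense :: "('p \<times> 'p) set set \<Rightarrow> ('p \<times> 'p) set \<Rightarrow> ('p \<times> 'p) set \<Rightarrow> bool" where
  "codense B f g \<longleftrightarrow> dense_in B f g \<and> dense_in B g f"

lemma dense_inD: "\<lbrakk>dense_in B f g; x \<in> B; x \<noteq> {}; x \<subseteq> f\<rbrakk> \<Longrightarrow> x \<inter> g \<noteq> {}"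
  by (simp add: dense_in_def)

lemma dense_in_subset: "f \<subseteq> g \<Longrightarrow> dense_in B f g"
  unfolding dense_in_def by blast

lemma codense_refl: "codense B f f"
  by (simp add: codense_def dense_in_subset)

lemma codense_sym: "codense B f g \<Longrightarrow> codense B g f"
  by (simp add: codense_def)

context relation_rep
begin

lemma partial_unions_subset:
  assumes "f \<in> partial_unions B" "(q, p) \<in> f"
  obtains a where "a \<in> B" "a \<subseteq> f" "(q, p) \<in> a"
proof -
  obtain K where "K \<subseteq> B" "f = \<Union>K"
    using assms(1) unfolding partial_unions_def by blast
  moreover obtain a where "a \<in> K" "(q, p) \<in> a" using calculation assms(2) by blast
  ultimately show thesis using that[of a] by blast
qed

text \<open>The middle relation has to be a union of members of \<open>B\<close>: the overlap of
  \<open>x\<close> with \<open>g\<close> is shrunk to one such member to obtain a test relation for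
  the second density.\<close>

lemma dense_in_trans:
  assumes g: "g \<in> partial_unions B" and fg: "dense_in B f g" and gh: "dense_in B g h"
  shows "dense_in B f h"
  unfolding dense_in_def
proof (intro ballI impI)
  fix x assume x: "x \<in> B" "x \<noteq> {}" "x \<subseteq> f"
  then have "x \<inter> g \<noteq> {}" using dense_inD[OF fg] by blast
  then obtain q p where qp: "(q, p) \<in> x" "(q, p) \<in> g" by fastforce
  obtain a where a: "a \<in> B" "a \<subseteq> g" "(q, p) \<in> a"
    using partial_unions_subset[OF g qp(2)] .
  have "x \<inter> a \<in> B" using x(1) a(1) by (rule inter)
  moreover have "x \<inter> a \<noteq> {}" "x \<inter> a \<subseteq> g" using a(2,3) qp(1) by blast+
  ultimately have "(x \<inter> a) \<inter> h \<noteq> {}"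
    by (intro dense_inD[OF gh])
  then show "x \<inter> h \<noteq> {}" by blast
qed

lemma codense_trans:
  "\<lbrakk>g \<in> partial_unions B; codense B f g; codense B g h\<rbrakk> \<Longrightarrow> codense B f h"
  unfolding codense_def using dense_in_trans[of g f h] dense_in_trans[of g h f] by simp

text \<open>The factors are replaced one after the other, and after each replacement the test
  relation is pulled back to the other factor. \<open>B\<close> is closed under composition,
  converse and intersection, so every pulled-back piece is again a legitimate test relation.\<close>

lemma dense_in_comp:
  assumes f: "f \<in> partial_unions B" and g: "g \<in> partial_unions B" and g': "g' \<in> partial_unions B"
    and ff': "dense_in B f f'" and gg': "dense_in B g g'"
  shows "dense_in B (f O g) (f' O g')"
  unfolding dense_in_def
proof (intro ballI impI)
  fix x assume x: "x \<in> B" "x \<noteq> {}" "x \<subseteq> f O g"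
  then obtain q m p where qmp: "(q, p) \<in> x" "(q, m) \<in> f" "(m, p) \<in> g" by fastforce
  obtain a where a: "a \<in> B" "a \<subseteq> f" "(q, m) \<in> a"
    using partial_unions_subset[OF f qmp(2)] .
  obtain b where b: "b \<in> B" "b \<subseteq> g" "(m, p) \<in> b"
    using partial_unions_subset[OF g qmp(3)] .
  \<comment> \<open>The pairs of \<open>b\<close> whose composite with a pair of \<open>a\<close>
    stays in \<open>x\<close>; density of \<open>g\<close> in \<open>g'\<close> is tested on
    them.\<close>
  define b' where "b' = b \<inter> (a\<inverse> O x)"
  have "b' \<in> B" unfolding b'_def using a b x by (intro inter comp_in converse)
  moreover have "b' \<noteq> {}" "b' \<subseteq> g" using a b qmp unfolding b'_def by auto
  ultimately have "b' \<inter> g' \<noteq> {}" by (intro dense_inD[OF gg'])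
  then obtain m1 p1 where mp1: "(m1, p1) \<in> b'" "(m1, p1) \<in> g'" by fastforce
  obtain b1 where b1: "b1 \<in> B" "b1 \<subseteq> g'" "(m1, p1) \<in> b1"
    using partial_unions_subset[OF g' mp1(2)] .
  \<comment> \<open>A piece on which the second factor already belongs to \<open>g'\<close> as
    well.\<close>
  define c where "c = b' \<inter> b1"
  have c: "c \<in> B" unfolding c_def using \<open>b' \<in> B\<close> b1 by (intro inter)
  obtain q1 where q1: "(q1, m1) \<in> a" "(q1, p1) \<in> x"
    using mp1(1) unfolding b'_def by blast
  \<comment> \<open>The pairs of \<open>a\<close> that can be continued by a pair of
    \<open>c\<close> to reach \<open>x\<close>. Any of them found in \<open>f'\<close> therefore
    comes with a continuation in \<open>g'\<close>.\<close>
  define a' where "a' = a \<inter> (x O c\<inverse>)"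
  have "a' \<in> B" unfolding a'_def using a c x by (intro inter comp_in converse)
  moreover have "(q1, m1) \<in> a'" using q1 mp1 b1 unfolding a'_def c_def by blast
  moreover have "a' \<subseteq> f" using a unfolding a'_def by blast
  ultimately have "a' \<inter> f' \<noteq> {}" by (intro dense_inD[OF ff']) blast+
  then obtain q2 m2 where "(q2, m2) \<in> a'" "(q2, m2) \<in> f'" by fastforce
  then obtain p2 where "(q2, p2) \<in> x" "(m2, p2) \<in> g'"
    using b1 unfolding a'_def c_def by blast
  then show "x \<inter> f' O g' \<noteq> {}" using \<open>(q2, m2) \<in> f'\<close> by blast
qed

lemma codense_comp:
  "\<lbrakk>f \<in> partial_unions B; f' \<in> partial_unions B; g \<in> partial_unions B; g' \<in> partial_unions B;
    codense B f f'; codense B g g'\<rbrakk> \<Longrightarrow> codense B (f O g) (f' O g')"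
  unfolding codense_def by (simp add: dense_in_comp)

lemma partial_unions_comp:
  assumes "f \<in> partial_unions B" "g \<in> partial_unions B"
  shows "f O g \<in> partial_unions B"
proof -
  obtain I J where "I \<in> carrier (FC S)" "J \<in> carrier (FC S)" "f = \<Union>(\<theta> ` I)" "g = \<Union>(\<theta> ` J)"
    using assms unfolding FC_Union_image[symmetric] by blast
  then show ?thesis
    unfolding FC_Union_image[symmetric] using FC_mult[of I J]
    by (intro image_eqI[of _ _ "I \<cdot>\<^bsub>FC S\<^esub> J"]) simp_all
qed

section \<open>Equivalence classes of ideals, indexed by relations\<close>

definition codense_class :: "('p \<times> 'p) set \<Rightarrow> 's set set" where
  "codense_class f = {I \<in> carrier (FC S). codense B f (\<Union>(\<theta> ` I))}"

lemma FC_obtain: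
  assumes "f \<in> partial_unions B"
  obtains I where "I \<in> carrier (FC S)" "\<Union>(\<theta> ` I) = f"
  using assms that unfolding FC_Union_image[symmetric] by (elim imageE) simp

lemma FC_Union_in: "I \<in> carrier (FC S) \<Longrightarrow> \<Union>(\<theta> ` I) \<in> partial_unions B"
  unfolding FC_Union_image[symmetric] by blast

lemma codense_class_nonempty: "f \<in> partial_unions B \<Longrightarrow> codense_class f \<noteq> {}"
  unfolding codense_class_def by (metis (mono_tags) FC_obtain codense_refl empty_iff mem_Collect_eq)

lemma FC_rel_Image:
  "I \<in> carrier (FC S) \<Longrightarrow> FC_rel S `` {I} = codense_class (\<Union>(\<theta> ` I))"
  unfolding codense_class_def codense_def using FC_rel_iff[of I] by blast

lemma codense_class_eq:
  assumes "f \<in> partial_unions B" "g \<in> partial_unions B" "codense B f g"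
  shows "codense_class f = codense_class g"
  unfolding codense_class_def
  using codense_trans[OF assms(1) codense_sym[OF assms(3)]] codense_trans[OF assms(2,3)]
  by blast

lemma codense_class_eq_iff:
  assumes "f \<in> partial_unions B" "g \<in> partial_unions B"
  shows "codense_class f = codense_class g \<longleftrightarrow> codense B f g"
proof
  assume eq: "codense_class f = codense_class g"
  obtain I where I: "I \<in> carrier (FC S)" "\<Union>(\<theta> ` I) = g"
    using FC_obtain assms(2) by blast
  then have "I \<in> codense_class g" by (simp add: codense_class_def codense_refl)
  then have "I \<in> codense_class f" using eq by simp
  then show "codense B f g" using I by (simp add: codense_class_def)
qed (rule codense_class_eq[OF assms])

lemma FC_quotient_carrier:
  "carrier (quotient_semigroup0 (FC S) (FC_rel S)) = codense_class ` partial_unions B"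
proof -
  have "carrier (FC S) // FC_rel S = (\<lambda>I. FC_rel S `` {I}) ` carrier (FC S)"
    by (auto simp: quotient_def)
  also have "\<dots> = (\<lambda>I. codense_class (\<Union>(\<theta> ` I))) ` carrier (FC S)"
    by (intro image_cong refl FC_rel_Image)
  also have "\<dots> = codense_class ` (\<lambda>I. \<Union>(\<theta> ` I)) ` carrier (FC S)"
    by (simp add: image_image)
  finally show ?thesis by (simp only: FC_Union_image) (simp add: quotient_semigroup0_def)
qed

text \<open>The quotient product is a union over all representatives. Its terms coincide because
  codensity respects composition, and the classes are nonempty, so the union collapses to this
  common value.\<close>

lemma FC_quotient_mult:
  assumes f: "f \<in> partial_unions B" and g: "g \<in> partial_unions B"
  shows "smult (quotient_semigroup0 (FC S) (FC_rel S)) (codense_class f) (codense_class g) =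
    codense_class (f O g)"
proof -
  have *: "FC_rel S `` {I \<cdot>\<^bsub>FC S\<^esub> J} = codense_class (f O g)"
    if "I \<in> codense_class f" "J \<in> codense_class g" for I J
  proof -
    have I: "I \<in> carrier (FC S)" "codense B f (\<Union>(\<theta> ` I))"
      and J: "J \<in> carrier (FC S)" "codense B g (\<Union>(\<theta> ` J))"
      using that by (auto simp: codense_class_def)
    have "codense B (\<Union>(\<theta> ` I) O \<Union>(\<theta> ` J)) (f O g)"
      using I J f g FC_Union_in codense_comp codense_sym by blast
    then have "codense_class (\<Union>(\<theta> ` I) O \<Union>(\<theta> ` J)) = codense_class (f O g)"
      using I J f g FC_Union_in partial_unions_comp by (intro codense_class_eq) blast+
    then show ?thesis
      using FC_rel_Image[OF FC_mult(1)[OF I(1) J(1)]] FC_mult(2)[OF I(1) J(1)] by simp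
  qed
  have "smult (quotient_semigroup0 (FC S) (FC_rel S)) (codense_class f) (codense_class g) =
    (\<Union>I\<in>codense_class f. \<Union>J\<in>codense_class g. codense_class (f O g))"
    using * by (simp add: quotient_semigroup0_def)
  also have "\<dots> = codense_class (f O g)"
    using codense_class_nonempty[OF f] codense_class_nonempty[OF g] by simp
  finally show ?thesis .
qed

section \<open>The quotient by \<leftrightarrow>\<close>

lemma lenz_rel_iff:
  "(s, t) \<in> lenz_rel S \<longleftrightarrow> s \<in> carrier S \<and> t \<in> carrier S \<and> codense B (\<theta> s) (\<theta> t)"
  using arrow_iff[of "{s}" "{t}"] arrow_iff[of "{t}" "{s}"]
  by (auto simp: lenz_rel_def lenz_equiv_def codense_def)

text \<open>If codense members of \<open>B\<close> are equal, the classes are singletons; the union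
  in the new representation merely strips the braces, so the family \<open>B\<close> is
  unchanged.\<close>

lemma lenz_quotient_rep:
  assumes separated: "\<And>f g. \<lbrakk>f \<in> B; g \<in> B; codense B f g\<rbrakk> \<Longrightarrow> f = g"
  shows "relation_rep (lenz_quotient S) (\<lambda>U. \<Union>(\<theta> ` U)) B"
proof -
  have cls: "lenz_rel S `` {s} = {s}" if "s \<in> carrier S" for s
  proof -
    have "codense B (\<theta> s) (\<theta> t) \<longleftrightarrow> t = s" if "t \<in> carrier S" for t
      using separated[OF rep_in rep_in, of s t] rep_eq_iff[of s t] codense_refl \<open>s \<in> carrier S\<close> that
      by auto
    then show ?thesis using that by (auto simp: lenz_rel_iff)
  qed
  have carr: "carrier (lenz_quotient S) = (\<lambda>s. {s}) ` carrier S"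
  proof -
    have "carrier S // lenz_rel S = (\<lambda>s. lenz_rel S `` {s}) ` carrier S"
      by (auto simp: quotient_def)
    also have "\<dots> = (\<lambda>s. {s}) ` carrier S"
      by (intro image_cong refl cls)
    finally show ?thesis by (simp add: lenz_quotient_def quotient_semigroup0_def)
  qed
  have mult: "{s} \<cdot>\<^bsub>lenz_quotient S\<^esub> {t} = {s \<cdot> t}"
    if "s \<in> carrier S" "t \<in> carrier S" for s t
    using that cls[OF mult_closed] by (simp add: lenz_quotient_def quotient_semigroup0_def)
  have zero: "szero (lenz_quotient S) = {szero S}"
    using cls[OF zero_closed] by (simp add: lenz_quotient_def quotient_semigroup0_def)
  show ?thesis
  proof
    show "inj_on (\<lambda>U. \<Union>(\<theta> ` U)) (carrier (lenz_quotient S))"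
      using inj unfolding carr by (auto simp: inj_on_def)
    show "(\<lambda>U. \<Union>(\<theta> ` U)) ` carrier (lenz_quotient S) = B"
      using image unfolding carr by (simp add: image_image)
    fix s t assume "s \<in> carrier (lenz_quotient S)" "t \<in> carrier (lenz_quotient S)"
    then obtain s' t' where st: "s = {s'}" "t = {t'}" "s' \<in> carrier S" "t' \<in> carrier S"
      unfolding carr by blast
    then show "s \<cdot>\<^bsub>lenz_quotient S\<^esub> t \<in> carrier (lenz_quotient S)"
      using mult mult_closed by (auto simp: carr)
    show "\<Union>(\<theta> ` (s \<cdot>\<^bsub>lenz_quotient S\<^esub> t)) = \<Union>(\<theta> ` s) O \<Union>(\<theta> ` t)"
      using st mult rep_mult by simp
  qed (use zero zero_closed rep_zero biunique converse inter in \<open>auto simp: carr\<close>)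
qed

end

section \<open>Relations on a free act\<close>

lemma ract_Nil [simp]: "ract p [] = p"
  and ract_ract [simp]: "ract (ract p v) w = ract p (v @ w)"
  and ract_left_inject [simp]: "ract p w = ract q w \<longleftrightarrow> p = q"
  and ract_right_inject [simp]: "ract p v = ract p w \<longleftrightarrow> v = w"
  by (auto simp: ract_def prod_eq_iff)

text \<open>Two prefixes of a common word are comparable; \<open>z\<close> is the surplus of the
  longer one.\<close>

lemma ract_eq_cases:
  assumes "ract p v = ract q w"
  obtains z where "p = ract q z" "w = z @ v" | z where "q = ract p z" "v = z @ w"
proof -
  have "fst p = fst q" "snd p @ v = snd q @ w"
    using assms by (simp_all add: ract_def)
  then obtain us where "snd p = snd q @ us \<and> us @ v = w \<or> snd p @ us = snd q \<and> v = us @ w"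
    unfolding append_eq_append_conv2 by blast
  then show thesis
    using that[of us] \<open>fst p = fst q\<close> by (auto simp: ract_def prod_eq_iff)
qed

lemma ract_in_iff [simp]:
  "ract p v \<in> X \<times> lists A \<longleftrightarrow> p \<in> X \<times> lists A \<and> v \<in> lists A"
  by (cases p) (auto simp: ract_def)

definition basic :: "'a set \<Rightarrow> 'x \<times> 'a list \<Rightarrow> 'x \<times> 'a list
    \<Rightarrow> (('x \<times> 'a list) \<times> ('x \<times> 'a list)) set" where
  "basic A q p = (\<lambda>w. (ract q w, ract p w)) ` lists A"

definition basics :: "'x set \<Rightarrow> 'a set \<Rightarrow> (('x \<times> 'a list) \<times> ('x \<times> 'a list)) set set" where
  "basics X A = insert {} {basic A q p | q p. q \<in> X \<times> lists A \<and> p \<in> X \<times> lists A}"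

text \<open>A subact of the square of the free act under the diagonal action. A partial morphism of
  acts has such a graph.\<close>

definition act_rel :: "'x set \<Rightarrow> 'a set \<Rightarrow> (('x \<times> 'a list) \<times> ('x \<times> 'a list)) set \<Rightarrow> bool" where
  "act_rel X A f \<longleftrightarrow> f \<subseteq> (X \<times> lists A) \<times> (X \<times> lists A) \<and>
     (\<forall>q p v. (q, p) \<in> f \<longrightarrow> v \<in> lists A \<longrightarrow> (ract q v, ract p v) \<in> f)"

lemma basic_refl [simp]: "(q, p) \<in> basic A q p"
  by (auto simp: basic_def intro!: image_eqI[of _ _ "[]"])

lemma basicE:
  assumes "(q', p') \<in> basic A q p"
  obtains w where "w \<in> lists A" "q' = ract q w" "p' = ract p w"
  using assms by (auto simp: basic_def)

lemma basicI: "w \<in> lists A \<Longrightarrow> (ract q w, ract p w) \<in> basic A q p"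
  by (simp add: basic_def)

lemma basic_biunique: "biunique (basic A q p)"
  by (rule biuniqueI) (erule basicE, erule basicE, simp)+

lemma basic_converse: "(basic A q p)\<inverse> = basic A p q"
  by (auto simp: basic_def)

lemma basic_subset:
  assumes "z \<in> lists A"
  shows "basic A (ract q z) (ract p z) \<subseteq> basic A q p"
proof (rule subrelI)
  fix q' p' assume "(q', p') \<in> basic A (ract q z) (ract p z)"
  then obtain w where "w \<in> lists A" "q' = ract q (z @ w)" "p' = ract p (z @ w)"
    by (elim basicE) simp
  then show "(q', p') \<in> basic A q p" using basicI[of "z @ w" A q p] assms by simp
qed

text \<open>Two \<open>basic\<close> relations are disjoint or nested. Comparing prefixes in the
  first coordinate yields \<open>z\<close>; right cancellation shows that the same \<open>z\<close>
  works in the second.\<close>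

lemma basic_inter_cases:
  assumes "basic A q p \<inter> basic A q' p' \<noteq> {}"
  obtains z where "z \<in> lists A" "q = ract q' z" "p = ract p' z"
  | z where "z \<in> lists A" "q' = ract q z" "p' = ract p z"
proof -
  obtain w w' where w: "w \<in> lists A" "w' \<in> lists A"
    and q: "ract q w = ract q' w'" and p: "ract p w = ract p' w'"
  proof -
    obtain x where "x \<in> basic A q p" "x \<in> basic A q' p'" using assms by blast
    then show thesis using that unfolding basic_def by force
  qed
  show thesis
    using q
  proof (cases rule: ract_eq_cases)
    case (1 z)
    then have "ract p w = ract (ract p' z) w" using p by simp
    then have "p = ract p' z" by (simp only: ract_left_inject)
    moreover have "z \<in> lists A" using 1 w by simp
    ultimately show thesis using 1 that by blast
  next
    case (2 z)
    then have "ract p' w' = ract (ract p z) w'" using p by simp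
    then have "p' = ract p z" by (simp only: ract_left_inject)
    moreover have "z \<in> lists A" using 2 w by simp
    ultimately show thesis using 2 that by blast
  qed
qed

lemma basics_cases:
  assumes "f \<in> basics X A"
  obtains "f = {}"
  | q p where "q \<in> X \<times> lists A" "p \<in> X \<times> lists A" "f = basic A q p"
  using assms unfolding basics_def by blast

lemma basics_empty: "{} \<in> basics X A"
  and basics_basic: "\<lbrakk>q \<in> X \<times> lists A; p \<in> X \<times> lists A\<rbrakk> \<Longrightarrow> basic A q p \<in> basics X A"
  unfolding basics_def by blast+

lemma basics_biunique: "f \<in> basics X A \<Longrightarrow> biunique f"
  by (erule basics_cases) (auto intro: basic_biunique biuniqueI)

lemma basics_converse: "f \<in> basics X A \<Longrightarrow> f\<inverse> \<in> basics X A"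
  by (erule basics_cases) (simp_all add: basic_converse basics_empty basics_basic)

lemma basics_inter:
  assumes f: "f \<in> basics X A" and g: "g \<in> basics X A"
  shows "f \<inter> g \<in> basics X A"
proof (cases "f \<inter> g = {}")
  case False
  obtain q p where qp: "f = basic A q p"
    using f False by (elim basics_cases) simp_all
  obtain q' p' where qp': "g = basic A q' p'"
    using g False by (elim basics_cases) simp_all
  have "f \<subseteq> g \<or> g \<subseteq> f"
    using False unfolding qp qp' by (elim basic_inter_cases) (simp_all add: basic_subset)
  then show ?thesis using f g by (metis inf.absorb1 inf.absorb2)
qed (simp add: basics_empty)

lemma basics_act_rel: "f \<in> basics X A \<Longrightarrow> act_rel X A f"
proof (erule basics_cases)
  fix q p assume "q \<in> X \<times> lists A" "p \<in> X \<times> lists A" "f = basic A q p"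
  then show "act_rel X A f"
    unfolding act_rel_def
    by (intro conjI allI impI subrelI; hypsubst; elim basicE)
      (simp_all add: basicI mem_Sigma_iff[of _ _ "X \<times> lists A"] del: mem_Sigma_iff)
qed (simp add: act_rel_def)

lemma partial_unions_act_rel: "f \<in> partial_unions (basics X A) \<Longrightarrow> act_rel X A f"
proof -
  assume "f \<in> partial_unions (basics X A)"
  then obtain K where K: "K \<subseteq> basics X A" "f = \<Union>K"
    unfolding partial_unions_def by blast
  then have *: "act_rel X A k" if "k \<in> K" for k
    using that basics_act_rel by blast
  then have "k \<subseteq> (X \<times> lists A) \<times> (X \<times> lists A)" if "k \<in> K" for k
    using that unfolding act_rel_def by blast
  moreover have "(ract q v, ract p v) \<in> f" if "(q, p) \<in> f" "v \<in> lists A" for q p v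
  proof -
    obtain k where "k \<in> K" "(q, p) \<in> k" using \<open>(q, p) \<in> f\<close> K(2) by blast
    then have "(ract q v, ract p v) \<in> k"
      using *[of k] \<open>v \<in> lists A\<close> unfolding act_rel_def by blast
    then show ?thesis using \<open>k \<in> K\<close> K(2) by blast
  qed
  ultimately show ?thesis unfolding act_rel_def K(2) by blast
qed

lemma act_relD:
  assumes "act_rel X A f" "(q, p) \<in> f"
  shows "q \<in> X \<times> lists A" "p \<in> X \<times> lists A" "v \<in> lists A \<Longrightarrow> (ract q v, ract p v) \<in> f"
  using assms unfolding act_rel_def by blast+

text \<open>A pair of \<open>f\<close> and the \<open>basic\<close> relation it generates determine
  each other, so testing on members of \<open>basics\<close> is testing on single pairs followed by
  an extension.\<close>

lemma dense_in_basics_iff: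
  assumes f: "act_rel X A f"
  shows "dense_in (basics X A) f g \<longleftrightarrow>
    (\<forall>q p. (q, p) \<in> f \<longrightarrow> (\<exists>v\<in>lists A. (ract q v, ract p v) \<in> g))"
proof
  assume D: "dense_in (basics X A) f g"
  show "\<forall>q p. (q, p) \<in> f \<longrightarrow> (\<exists>v\<in>lists A. (ract q v, ract p v) \<in> g)"
  proof (intro allI impI)
    fix q p assume qp: "(q, p) \<in> f"
    have "basic A q p \<in> basics X A"
      using act_relD[OF f qp] by (intro basics_basic)
    moreover have "basic A q p \<noteq> {}" using basic_refl by blast
    moreover have "basic A q p \<subseteq> f"
      by (intro subrelI, elim basicE) (simp add: act_relD(3)[OF f qp])
    ultimately have "basic A q p \<inter> g \<noteq> {}" by (intro dense_inD[OF D])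
    then show "\<exists>v\<in>lists A. (ract q v, ract p v) \<in> g"
      by (auto simp: basic_def)
  qed
next
  assume *: "\<forall>q p. (q, p) \<in> f \<longrightarrow> (\<exists>v\<in>lists A. (ract q v, ract p v) \<in> g)"
  show "dense_in (basics X A) f g"
    unfolding dense_in_def
  proof (intro ballI impI)
    fix x assume x: "x \<in> basics X A" "x \<noteq> {}" "x \<subseteq> f"
    then obtain q p where "x = basic A q p" by (elim basics_cases) simp_all
    moreover have "(q, p) \<in> f" using x calculation basic_refl by blast
    then obtain v where "v \<in> lists A" "(ract q v, ract p v) \<in> g" using * by blast
    ultimately show "x \<inter> g \<noteq> {}" using basicI by blast
  qed
qed

lemma basics_separated:
  assumes ab: "a \<in> A" "b \<in> A" "a \<noteq> b"
    and f: "f \<in> basics X A" and g: "g \<in> basics X A" and fg: "codense (basics X A) f g"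
  shows "f = g"
proof -
  have D: "dense_in (basics X A) f g" "dense_in (basics X A) g f"
    using fg by (simp_all add: codense_def)
  \<comment> \<open>A \<open>basic\<close> relation is dense in a restriction of itself only if that
    restriction is trivial.\<close>
  have eq: "u = v" if z: "z \<in> lists A" and u: "u = basic A (ract q z) (ract p z)"
    and v: "v = basic A q p" "v \<in> basics X A" and vu: "dense_in (basics X A) v u" for u v q p z
  proof (cases z)
    case (Cons c z')
    \<comment> \<open>A letter different from the first letter of \<open>z\<close>: no extension of
      \<open>(ract q [d], ract p [d])\<close> can pass through \<open>z\<close>, so none reaches
      \<open>u\<close>.\<close>
    obtain d where d: "d \<in> A" "d \<noteq> c" using ab by metis
    then have "(ract q [d], ract p [d]) \<in> v" unfolding v(1) by (intro basicI) simp
    then obtain w where "(ract (ract q [d]) w, ract (ract p [d]) w) \<in> u"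
      using vu dense_in_basics_iff[OF basics_act_rel[OF v(2)]] by blast
    then show ?thesis using d Cons unfolding u by (elim basicE) simp
  qed (simp add: u v)
  show ?thesis
  proof (cases "f \<inter> g = {}")
    case True
    \<comment> \<open>A nonempty \<open>f\<close> would be its own test relation and would have to
      meet \<open>g\<close>; likewise with the roles exchanged.\<close>
    then have "f = {}" "g = {}"
      using dense_inD[OF D(1) f] dense_inD[OF D(2) g] by blast+
    then show ?thesis by simp
  next
    case False
    obtain q p where qp: "f = basic A q p"
      using f False by (elim basics_cases) simp_all
    obtain q' p' where qp': "g = basic A q' p'"
      using g False by (elim basics_cases) simp_all
    have "basic A q p \<inter> basic A q' p' \<noteq> {}" using False qp qp' by simp
    then show ?thesis
    proof (cases rule: basic_inter_cases)
      case (1 z)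
      then show ?thesis using eq[of z f q' p' g] qp qp' g D by simp
    next
      case (2 z)
      then show ?thesis using eq[of z g q p f] qp qp' f D by simp
    qed
  qed
qed

section \<open>A faithful representation of the polycyclic monoid\<close>

lemma generated_congruence_subset: "R \<subseteq> generated_congruence S R"
  by (auto simp: generated_congruence_def)

lemma generated_congruence_least:
  "\<lbrakk>congruence S \<rho>; R \<subseteq> \<rho>\<rbrakk> \<Longrightarrow> generated_congruence S R \<subseteq> \<rho>"
  by (auto simp: generated_congruence_def)

lemma congruence_generated:
  assumes closed: "\<And>s t. \<lbrakk>s \<in> carrier S; t \<in> carrier S\<rbrakk> \<Longrightarrow> s \<cdot>\<^bsub>S\<^esub> t \<in> carrier S"
    and R: "R \<subseteq> carrier S \<times> carrier S"
  shows "congruence S (generated_congruence S R)"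
proof -
  \<comment> \<open>The full relation is a congruence containing \<open>R\<close>, which confines
    the intersection to the carrier.\<close>
  have full: "congruence S (carrier S \<times> carrier S)"
    by (auto simp: congruence_def closed intro!: equivI refl_onI symI transI)
  have mem: "(s, t) \<in> generated_congruence S R \<longleftrightarrow>
      (\<forall>\<rho>. congruence S \<rho> \<longrightarrow> R \<subseteq> \<rho> \<longrightarrow> (s, t) \<in> \<rho>)" for s t
    by (simp add: generated_congruence_def imp_conjL)
  have equiv: "equiv (carrier S) \<rho>" if "congruence S \<rho>" for \<rho>
    using that by (simp add: congruence_def)
  show ?thesis
    unfolding congruence_def
  proof (intro conjI allI impI equivI)
    show "generated_congruence S R \<subseteq> carrier S \<times> carrier S"
      using generated_congruence_least[OF full R] .
    show "refl_on (carrier S) (generated_congruence S R)"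
    proof (rule refl_onI, unfold mem, intro allI impI)
      fix s \<rho> assume "s \<in> carrier S" "congruence S \<rho>"
      then show "(s, s) \<in> \<rho>" using equiv[of \<rho>] unfolding equiv_def by (meson refl_onD)
    qed
    show "sym (generated_congruence S R)"
    proof (rule symI, unfold mem, intro allI impI)
      fix s t \<rho> assume "\<forall>\<rho>. congruence S \<rho> \<longrightarrow> R \<subseteq> \<rho> \<longrightarrow> (s, t) \<in> \<rho>" "congruence S \<rho>" "R \<subseteq> \<rho>"
      then show "(t, s) \<in> \<rho>" using equiv[of \<rho>] unfolding equiv_def by (simp add: symD)
    qed
    show "trans (generated_congruence S R)"
    proof (rule transI, unfold mem, intro allI impI)
      fix s t u \<rho> assume "\<forall>\<rho>. congruence S \<rho> \<longrightarrow> R \<subseteq> \<rho> \<longrightarrow> (s, t) \<in> \<rho>"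
        "\<forall>\<rho>. congruence S \<rho> \<longrightarrow> R \<subseteq> \<rho> \<longrightarrow> (t, u) \<in> \<rho>" and \<rho>: "congruence S \<rho>" "R \<subseteq> \<rho>"
      then have "(s, t) \<in> \<rho>" "(t, u) \<in> \<rho>" by simp_all
      then show "(s, u) \<in> \<rho>" using equiv[OF \<rho>(1)] unfolding equiv_def by (meson transD)
    qed
  next
    fix s t u v
    assume "(s, t) \<in> generated_congruence S R" "(u, v) \<in> generated_congruence S R"
    then show "(s \<cdot>\<^bsub>S\<^esub> u, t \<cdot>\<^bsub>S\<^esub> v) \<in> generated_congruence S R"
      unfolding mem by (simp add: congruence_def)
  qed
qed

text \<open>\<open>h\<close> is constant on each class, so the union of its values there is that
  value, without a choice of representative. Injectivity reflects that \<open>\<rho>\<close> is the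
  entire kernel of \<open>h\<close>.\<close>

lemma quotient_faithful_rep:
  assumes kernel: "\<rho> = {(s, t). s \<in> carrier S \<and> t \<in> carrier S \<and> h s = h t}"
    and closed: "\<And>s t. \<lbrakk>s \<in> carrier S; t \<in> carrier S\<rbrakk> \<Longrightarrow> s \<cdot>\<^bsub>S\<^esub> t \<in> carrier S"
    and h_mult: "\<And>s t. \<lbrakk>s \<in> carrier S; t \<in> carrier S\<rbrakk> \<Longrightarrow> h (s \<cdot>\<^bsub>S\<^esub> t) = h s O h t"
    and zero: "szero S \<in> carrier S" "h (szero S) = {}"
  shows "faithful_rep (quotient_semigroup0 S \<rho>) (\<lambda>U. \<Union>(h ` U))"
    and "(\<lambda>U. \<Union>(h ` U)) ` carrier (quotient_semigroup0 S \<rho>) = h ` carrier S"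
proof -
  have cls: "\<rho> `` {s} = {t \<in> carrier S. h t = h s}" if "s \<in> carrier S" for s
    using that by (auto simp: kernel)
  have U: "\<Union>(h ` \<rho> `` {s}) = h s" if "s \<in> carrier S" for s
    using that unfolding cls[OF that] by auto
  have carr: "carrier (quotient_semigroup0 S \<rho>) = (\<lambda>s. \<rho> `` {s}) ` carrier S"
    by (auto simp: quotient_semigroup0_def quotient_def)
  have mult: "smult (quotient_semigroup0 S \<rho>) (\<rho> `` {s}) (\<rho> `` {t}) = \<rho> `` {s \<cdot>\<^bsub>S\<^esub> t}"
    if s: "s \<in> carrier S" and t: "t \<in> carrier S" for s t
  proof -
    have *: "\<rho> `` {x \<cdot>\<^bsub>S\<^esub> y} = \<rho> `` {s \<cdot>\<^bsub>S\<^esub> t}" if "x \<in> \<rho> `` {s}" "y \<in> \<rho> `` {t}" for x y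
      using that s t by (simp add: cls closed h_mult)
    have "s \<in> \<rho> `` {s}" "t \<in> \<rho> `` {t}" using s t by (simp_all add: cls)
    then have "(\<Union>x\<in>\<rho> `` {s}. \<Union>y\<in>\<rho> `` {t}. \<rho> `` {s \<cdot>\<^bsub>S\<^esub> t}) = \<rho> `` {s \<cdot>\<^bsub>S\<^esub> t}" by blast
    moreover have "smult (quotient_semigroup0 S \<rho>) (\<rho> `` {s}) (\<rho> `` {t}) =
        (\<Union>x\<in>\<rho> `` {s}. \<Union>y\<in>\<rho> `` {t}. \<rho> `` {x \<cdot>\<^bsub>S\<^esub> y})"
      by (simp add: quotient_semigroup0_def)
    ultimately show ?thesis using * by simp
  qed
  have z: "szero (quotient_semigroup0 S \<rho>) = \<rho> `` {szero S}"
    by (simp add: quotient_semigroup0_def)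
  show "faithful_rep (quotient_semigroup0 S \<rho>) (\<lambda>U. \<Union>(h ` U))"
  proof
    show "inj_on (\<lambda>U. \<Union>(h ` U)) (carrier (quotient_semigroup0 S \<rho>))"
    proof (rule inj_onI, unfold carr, elim imageE, hypsubst)
      fix s t assume eq: "\<Union>(h ` \<rho> `` {s}) = \<Union>(h ` \<rho> `` {t})"
        and st: "s \<in> carrier S" "t \<in> carrier S"
      then have "h s = h t" by (simp only: U)
      then show "\<rho> `` {s} = \<rho> `` {t}" using st by (simp only: cls)
    qed
    show "szero (quotient_semigroup0 S \<rho>) \<in> carrier (quotient_semigroup0 S \<rho>)"
      unfolding z carr using zero by blast
    show "\<Union>(h ` szero (quotient_semigroup0 S \<rho>)) = {}"
      unfolding z using U zero by simp
    fix u v assume "u \<in> carrier (quotient_semigroup0 S \<rho>)" "v \<in> carrier (quotient_semigroup0 S \<rho>)"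
    then obtain s t where st: "s \<in> carrier S" "t \<in> carrier S" "u = \<rho> `` {s}" "v = \<rho> `` {t}"
      unfolding carr by blast
    show "smult (quotient_semigroup0 S \<rho>) u v \<in> carrier (quotient_semigroup0 S \<rho>)"
      unfolding st mult[OF st(1,2)] carr using closed[OF st(1,2)] by blast
    show "\<Union>(h ` smult (quotient_semigroup0 S \<rho>) u v) = \<Union>(h ` u) O \<Union>(h ` v)"
      unfolding st mult[OF st(1,2)] U[OF st(1)] U[OF st(2)] U[OF closed[OF st(1,2)]]
      by (rule h_mult[OF st(1,2)])
  qed
  show "(\<lambda>U. \<Union>(h ` U)) ` carrier (quotient_semigroup0 S \<rho>) = h ` carrier S"
    unfolding carr image_image by (intro image_cong refl U)
qed

section \<open>The action of the polycyclic generators on words\<close>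

fun letter_rel :: "nat set \<Rightarrow> letter \<Rightarrow> (nat list \<times> nat list) set" where
  "letter_rel A (Gen a) = {(a # w, w) | w. a # w \<in> lists A}"
| "letter_rel A (GenInv a) = {(w, a # w) | w. a # w \<in> lists A}"

fun word_rel :: "nat set \<Rightarrow> letter list \<Rightarrow> (nat list \<times> nat list) set" where
  "word_rel A [] = Id_on (lists A)"
| "word_rel A (c # u) = letter_rel A c O word_rel A u"

definition word0_rel :: "nat set \<Rightarrow> letter list option \<Rightarrow> (nat list \<times> nat list) set" where
  "word0_rel A u = (case u of None \<Rightarrow> {} | Some v \<Rightarrow> word_rel A v)"

lemma letter_rel_subset: "letter_rel A c \<subseteq> lists A \<times> lists A"
  by (cases c) auto

lemma word_rel_subset: "word_rel A u \<subseteq> lists A \<times> lists A"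
proof (induction u)
  case (Cons c u)
  then show ?case
    using relcomp_mono[OF letter_rel_subset[of A c] Cons.IH] by auto
qed auto

lemma word_rel_append: "word_rel A (u @ v) = word_rel A u O word_rel A v"
proof (induction u)
  case Nil
  have "Id_on (lists A) O word_rel A v = word_rel A v"
    using word_rel_subset[of A v] by blast
  then show ?case by simp
qed (simp add: O_assoc)

text \<open>The word for \<open>y x\<inverse>\<close>; inverting \<open>x\<close> reverses the order
  of its letters.\<close>

definition normal_form :: "nat list \<Rightarrow> nat list \<Rightarrow> letter list" where
  "normal_form y x = map Gen y @ map GenInv (rev x)"

text \<open>The action of \<open>y x\<inverse>\<close> on words: the prefix \<open>x\<close> of the
  argument is replaced by \<open>y\<close>.\<close>

definition prefix_rel :: "'a set \<Rightarrow> 'a list \<Rightarrow> 'a list \<Rightarrow> ('a list \<times> 'a list) set" where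
  "prefix_rel A y x = {(y @ w, x @ w) | w. w \<in> lists A}"

lemma prefix_rel_comp:
  "prefix_rel A y [] O prefix_rel A [] x = prefix_rel A y x"
  "y' \<in> lists A \<Longrightarrow> prefix_rel A y [] O prefix_rel A y' [] = prefix_rel A (y @ y') []"
  "x \<in> lists A \<Longrightarrow> prefix_rel A [] x O prefix_rel A [] x' = prefix_rel A [] (x' @ x)"
  by (auto simp: prefix_rel_def relcomp_unfold)

lemma letter_rel_prefix:
  assumes "a \<in> A"
  shows "letter_rel A (Gen a) = prefix_rel A [a] []" "letter_rel A (GenInv a) = prefix_rel A [] [a]"
  using assms by (auto simp: prefix_rel_def)

lemma Id_on_prefix: "Id_on (lists A) = prefix_rel A [] []"
  by (auto simp: prefix_rel_def)

lemma word_rel_Gen: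
  "y \<in> lists A \<Longrightarrow> word_rel A (map Gen y) = prefix_rel A y []"
proof (induction y)
  case (Cons a y)
  then show ?case by (simp add: letter_rel_prefix prefix_rel_comp del: letter_rel.simps)
qed (simp add: Id_on_prefix)

lemma word_rel_GenInv:
  "x \<in> lists A \<Longrightarrow> word_rel A (map GenInv (rev x)) = prefix_rel A [] x"
proof (induction x)
  case (Cons a x)
  then show ?case
    by (simp add: word_rel_append letter_rel_prefix prefix_rel_comp Id_on_prefix del: letter_rel.simps)
qed (simp add: Id_on_prefix)

lemma word_rel_normal_form:
  "\<lbrakk>y \<in> lists A; x \<in> lists A\<rbrakk> \<Longrightarrow> word_rel A (normal_form y x) = prefix_rel A y x"
  by (simp add: normal_form_def word_rel_append word_rel_Gen word_rel_GenInv prefix_rel_comp)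

lemma prefix_rel_nonempty: "(y, x) \<in> prefix_rel A y x"
  unfolding prefix_rel_def by force

text \<open>The pair \<open>(y, x)\<close> is the shortest one of its relation. If the relations
  agree, each of the two shortest pairs extends the other, so they coincide.\<close>

lemma prefix_rel_inject: "prefix_rel A y x = prefix_rel A y' x' \<longleftrightarrow> y = y' \<and> x = x'"
proof
  assume eq: "prefix_rel A y x = prefix_rel A y' x'"
  have "(y, x) \<in> prefix_rel A y' x'" "(y', x') \<in> prefix_rel A y x"
    using prefix_rel_nonempty eq by blast+
  then show "y = y' \<and> x = x'" by (auto simp: prefix_rel_def)
qed simp

section \<open>The defining congruence of the polycyclic monoid\<close>

abbreviation letters :: "nat set \<Rightarrow> letter set" where
  "letters A \<equiv> Gen ` A \<union> GenInv ` A"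

lemma normal_form_letters:
  "\<lbrakk>y \<in> lists A; x \<in> lists A\<rbrakk> \<Longrightarrow> normal_form y x \<in> lists (letters A)"
  by (auto simp: normal_form_def)

definition polycyclic_relators :: "nat set \<Rightarrow> (letter list option \<times> letter list option) set" where
  "polycyclic_relators A = {(Some [GenInv i, Gen i], Some []) | i. i \<in> A} \<union>
      {(Some [GenInv i, Gen j], None) | i j. i \<in> A \<and> j \<in> A \<and> i \<noteq> j}"

lemma polycyclic_eq:
  "polycyclic n = quotient_semigroup0 (free_monoid0 (letters {1..n}))
     (generated_congruence (free_monoid0 (letters {1..n})) (polycyclic_relators {1..n}))"
  by (simp add: polycyclic_def presented_monoid0_def polycyclic_relators_def)

lemma free_monoid0_mult [simp]:
  "Some u \<cdot>\<^bsub>free_monoid0 L\<^esub> Some v = Some (u @ v)"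
  "None \<cdot>\<^bsub>free_monoid0 L\<^esub> s = None"
  "s \<cdot>\<^bsub>free_monoid0 L\<^esub> None = None"
  by (auto simp: free_monoid0_def split: option.splits)

lemma free_monoid0_carrier [simp]:
  "None \<in> carrier (free_monoid0 L)" "Some u \<in> carrier (free_monoid0 L) \<longleftrightarrow> u \<in> lists L"
  by (auto simp: free_monoid0_def)

lemma free_monoid0_zero [simp]: "szero (free_monoid0 L) = None"
  by (simp add: free_monoid0_def)

lemma free_monoid0_closed:
  "\<lbrakk>s \<in> carrier (free_monoid0 L); t \<in> carrier (free_monoid0 L)\<rbrakk>
    \<Longrightarrow> s \<cdot>\<^bsub>free_monoid0 L\<^esub> t \<in> carrier (free_monoid0 L)"
  by (cases s; cases t) simp_all

lemma word0_rel_simps [simp]: "word0_rel A None = {}" "word0_rel A (Some u) = word_rel A u"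
  by (simp_all add: word0_rel_def)

lemma word0_rel_mult: "word0_rel A (s \<cdot>\<^bsub>free_monoid0 L\<^esub> t) = word0_rel A s O word0_rel A t"
  by (cases s; cases t) (simp_all add: word_rel_append)

lemma polycyclic_relators_carrier:
  "polycyclic_relators A \<subseteq> carrier (free_monoid0 (letters A)) \<times> carrier (free_monoid0 (letters A))"
  by (auto simp: polycyclic_relators_def)

text \<open>Letters are added on the left of a normal form, so at most one relator is applied per
  letter: a generator extends \<open>y\<close>, while an inverse generator cancels the head of
  \<open>y\<close>, meets a different head and gives zero, or passes to \<open>x\<close> when
  \<open>y\<close> is empty.\<close>

lemma polycyclic_congruence_normal_form:
  fixes A defines "\<rho> \<equiv> generated_congruence (free_monoid0 (letters A)) (polycyclic_relators A)"
  assumes "u \<in> lists (letters A)"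
  shows "(Some u, None) \<in> \<rho> \<or> (\<exists>y\<in>lists A. \<exists>x\<in>lists A. (Some u, Some (normal_form y x)) \<in> \<rho>)"
proof -
  let ?S = "free_monoid0 (letters A)"
  have cong: "congruence ?S \<rho>"
    unfolding \<rho>_def by (intro congruence_generated free_monoid0_closed polycyclic_relators_carrier)
  then have equiv: "equiv (carrier ?S) \<rho>"
    and mult: "\<And>s t u v. \<lbrakk>(s, t) \<in> \<rho>; (u, v) \<in> \<rho>\<rbrakk> \<Longrightarrow> (s \<cdot>\<^bsub>?S\<^esub> u, t \<cdot>\<^bsub>?S\<^esub> v) \<in> \<rho>"
    by (auto simp: congruence_def)
  have refl: "(s, s) \<in> \<rho>" if "s \<in> carrier ?S" for s
    using equiv that by (meson equiv_def refl_onD)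
  have trans: "\<lbrakk>(s, t) \<in> \<rho>; (t, u) \<in> \<rho>\<rbrakk> \<Longrightarrow> (s, u) \<in> \<rho>" for s t u
    using equiv by (meson equiv_def transD)
  have rel: "polycyclic_relators A \<subseteq> \<rho>"
    unfolding \<rho>_def by (rule generated_congruence_subset)
  show ?thesis
    using assms(2)
  proof (induction u)
    case Nil
    then show ?case
      using refl[of "Some []"] by (auto simp: normal_form_def intro!: bexI[of _ "[]"])
  next
    case (Cons c u)
    then have c: "c \<in> letters A" and IH: "(Some u, None) \<in> \<rho> \<or>
        (\<exists>y\<in>lists A. \<exists>x\<in>lists A. (Some u, Some (normal_form y x)) \<in> \<rho>)"
      by simp_all
    have cr: "(Some [c], Some [c]) \<in> \<rho>" using c by (intro refl) simp
    show ?case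
      using IH
    proof (elim disjE bexE)
      assume "(Some u, None) \<in> \<rho>"
      from mult[OF cr this] show ?thesis by simp
    next
      fix y x assume y: "y \<in> lists A" and x: "x \<in> lists A"
        and "(Some u, Some (normal_form y x)) \<in> \<rho>"
      from mult[OF cr this(3)]
      have step: "(Some (c # u), Some (c # normal_form y x)) \<in> \<rho>" by simp
      show ?thesis
      proof (cases c)
        case (Gen a)
        then have "c # normal_form y x = normal_form (a # y) x" "a # y \<in> lists A"
          using c y by (auto simp: normal_form_def)
        then show ?thesis using step x by metis
      next
        case (GenInv a)
        then have a: "a \<in> A" using c by auto
        show ?thesis
        proof (cases y)
          case Nil
          \<comment> \<open>Nothing is left to cancel: the new inverse letter stands in front of the
            inverse of \<open>x\<close>, so it becomes the last letter of \<open>x\<close>.\<close>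
          then have "c # normal_form y x = normal_form [] (x @ [a])" "x @ [a] \<in> lists A"
            using GenInv a x by (auto simp: normal_form_def)
          then show ?thesis using step by (metis lists.Nil)
        next
          case (Cons b y')
          then have b: "b \<in> A" "y' \<in> lists A" using y by auto
          have eq: "c # normal_form y x = [GenInv a, Gen b] @ normal_form y' x"
            using GenInv Cons by (simp add: normal_form_def)
          have r: "(Some (normal_form y' x), Some (normal_form y' x)) \<in> \<rho>"
            using normal_form_letters b x by (intro refl) simp
          show ?thesis
          proof (cases "a = b")
            case True
            then have "(Some [GenInv a, Gen b], Some []) \<in> \<rho>"
              using rel a by (auto simp: polycyclic_relators_def)
            from mult[OF this r] have "(Some (c # normal_form y x), Some (normal_form y' x)) \<in> \<rho>"
              unfolding eq by simp
            then show ?thesis using trans[OF step] b x by blast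
          next
            case False
            then have "(Some [GenInv a, Gen b], None) \<in> \<rho>"
              using rel a b by (auto simp: polycyclic_relators_def)
            from mult[OF this r] have "(Some (c # normal_form y x), None) \<in> \<rho>"
              unfolding eq by simp
            then show ?thesis using trans[OF step] by blast
          qed
        qed
      qed
    qed
  qed
qed

text \<open>The kernel of the action is a congruence containing the relators. Conversely, words with
  equal action reduce to the same normal form, because normal forms act differently; uniqueness thus
  comes from the action rather than from a confluence argument.\<close>

lemma polycyclic_congruence_eq:
  "generated_congruence (free_monoid0 (letters A)) (polycyclic_relators A) =
    {(s, t). s \<in> carrier (free_monoid0 (letters A)) \<and> t \<in> carrier (free_monoid0 (letters A)) \<and>
      word0_rel A s = word0_rel A t}" (is "?\<rho> = ?K")
proof
  let ?S = "free_monoid0 (letters A)"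
  have "congruence ?S ?K"
    by (auto simp: congruence_def free_monoid0_closed word0_rel_mult
        intro!: equivI refl_onI symI transI)
  moreover have "word_rel A [GenInv i, Gen i] = Id_on (lists A)" if "i \<in> A" for i
    using that by (auto simp: Id_on_def)
  moreover have "word_rel A [GenInv i, Gen j] = {}" if "i \<noteq> j" for i j
    using that by auto
  ultimately show "?\<rho> \<subseteq> ?K"
    by (intro generated_congruence_least) (auto simp: polycyclic_relators_def simp del: word_rel.simps(2))
  show "?K \<subseteq> ?\<rho>"
  proof (rule subrelI)
    fix s t assume "(s, t) \<in> ?K"
    then have s: "s \<in> carrier ?S" and t: "t \<in> carrier ?S" and st: "word0_rel A s = word0_rel A t"
      by simp_all
    have cong: "congruence ?S ?\<rho>"
      by (intro congruence_generated free_monoid0_closed polycyclic_relators_carrier)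
    then have equiv: "equiv (carrier ?S) ?\<rho>" by (simp add: congruence_def)
    define N where "N = insert None {Some (normal_form y x) | y x. y \<in> lists A \<and> x \<in> lists A}"
    have N: "\<exists>v\<in>N. (u, v) \<in> ?\<rho>" if "u \<in> carrier ?S" for u
    proof (cases u)
      case None
      have "(None, None) \<in> ?\<rho>"
        using equiv by (meson equiv_def refl_onD free_monoid0_carrier(1))
      then show ?thesis using None by (auto simp: N_def)
    next
      case (Some u')
      then show ?thesis
        using polycyclic_congruence_normal_form[of u' A] that unfolding N_def by auto
    qed
    have rel: "u = None \<and> word0_rel A u = {} \<or>
        (\<exists>y x. u = Some (normal_form y x) \<and> word0_rel A u = prefix_rel A y x)" if "u \<in> N" for u
    proof -
      from that consider "u = None"
        | y x where "y \<in> lists A" "x \<in> lists A" "u = Some (normal_form y x)"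
        unfolding N_def by blast
      then show ?thesis by cases (auto simp: word_rel_normal_form)
    qed
    have inj: "inj_on (word0_rel A) N"
    proof (rule inj_onI)
      fix u v assume "u \<in> N" "v \<in> N" "word0_rel A u = word0_rel A v"
      then show "u = v"
        using rel[of u] rel[of v] prefix_rel_nonempty by (metis empty_iff prefix_rel_inject)
    qed
    obtain s' where s': "s' \<in> N" "(s, s') \<in> ?\<rho>" using N s by blast
    obtain t' where t': "t' \<in> N" "(t, t') \<in> ?\<rho>" using N t by blast
    \<comment> \<open>By the inclusion already proved, reduction does not change the action.\<close>
    have "word0_rel A s = word0_rel A s'" "word0_rel A t = word0_rel A t'"
      using \<open>?\<rho> \<subseteq> ?K\<close> s' t' by blast+
    then have "s' = t'" using inj_onD[OF inj] s' t' st by simp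
    then show "(s, t) \<in> ?\<rho>"
      using s' t' equiv by (meson equiv_def symD transD)
  qed
qed

lemma polycyclic_faithful_rep:
  "faithful_rep (polycyclic n) (\<lambda>U. \<Union>(word0_rel {1..n} ` U))"
  "(\<lambda>U. \<Union>(word0_rel {1..n} ` U)) ` carrier (polycyclic n) =
     insert {} {prefix_rel {1..n} y x | y x. y \<in> lists {1..n} \<and> x \<in> lists {1..n}}"
proof -
  let ?A = "{1..n}"
  let ?S = "free_monoid0 (letters ?A)"
  note rep = quotient_faithful_rep[OF polycyclic_congruence_eq free_monoid0_closed word0_rel_mult,
      of ?A, folded polycyclic_eq]
  show "faithful_rep (polycyclic n) (\<lambda>U. \<Union>(word0_rel ?A ` U))"
    by (rule rep(1)) simp_all
  have "(\<lambda>U. \<Union>(word0_rel ?A ` U)) ` carrier (polycyclic n) = word0_rel ?A ` carrier ?S"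
    by (rule rep(2)) simp_all
  also have "\<dots> = insert {} {prefix_rel ?A y x | y x. y \<in> lists ?A \<and> x \<in> lists ?A}"
  proof (intro equalityI subsetI)
    fix f assume "f \<in> word0_rel ?A ` carrier ?S"
    then obtain s where s: "s \<in> carrier ?S" "f = word0_rel ?A s" by blast
    show "f \<in> insert {} {prefix_rel ?A y x | y x. y \<in> lists ?A \<and> x \<in> lists ?A}"
    proof (cases s)
      case (Some u)
      then have "u \<in> lists (letters ?A)" using s by simp
      then consider "word_rel ?A u = {}"
        | y x where "y \<in> lists ?A" "x \<in> lists ?A" "word_rel ?A u = word_rel ?A (normal_form y x)"
        using polycyclic_congruence_normal_form[of u ?A] unfolding polycyclic_congruence_eq
        by auto
      then show ?thesis
      proof cases
        case (2 y x)
        then have "f = prefix_rel ?A y x" using s Some by (simp add: word_rel_normal_form)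
        then show ?thesis using 2 by blast
      qed (simp add: s Some)
    qed (simp add: s)
  next
    fix f assume "f \<in> insert {} {prefix_rel ?A y x | y x. y \<in> lists ?A \<and> x \<in> lists ?A}"
    then consider "f = {}" | y x where "y \<in> lists ?A" "x \<in> lists ?A" "f = prefix_rel ?A y x"
      by blast
    then show "f \<in> word0_rel ?A ` carrier ?S"
    proof cases
      case 1
      then show ?thesis by (intro image_eqI[of _ _ None]) simp_all
    next
      case (2 y x)
      then show ?thesis
        using word_rel_normal_form[OF 2(1,2)] normal_form_letters[OF 2(1,2)]
        by (intro image_eqI[of _ _ "Some (normal_form y x)"]) simp_all
    qed
  qed
  finally show "(\<lambda>U. \<Union>(word0_rel ?A ` U)) ` carrier (polycyclic n) =
     insert {} {prefix_rel ?A y x | y x. y \<in> lists ?A \<and> x \<in> lists ?A}" .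
qed

section \<open>The Brandt extension\<close>

definition brandt_rel ::
    "('m \<Rightarrow> ('q \<times> 'q) set) \<Rightarrow> (nat \<times> 'm \<times> nat) option \<Rightarrow> ((nat \<times> 'q) \<times> (nat \<times> 'q)) set" where
  "brandt_rel \<eta> s = (case s of None \<Rightarrow> {} | Some (i, m, j) \<Rightarrow> {((i, y), (j, x)) | y x. (y, x) \<in> \<eta> m})"

lemma brandt_carrier_iff:
  "s \<in> carrier (brandt r M) \<longleftrightarrow> s = None \<or>
     (\<exists>i m j. s = Some (i, m, j) \<and> i \<in> {1..r} \<and> j \<in> {1..r} \<and> m \<in> carrier M \<and> m \<noteq> szero M)"
  by (auto simp: brandt_def)

text \<open>The triples exclude the zero of \<open>M\<close>, so each has a nonempty relation. Any
  pair of it shows both indices, and removing the indices recovers the relation of the middle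
  entry.\<close>

lemma brandt_faithful_rep:
  assumes "faithful_rep M \<eta>"
  shows "faithful_rep (brandt r M) (brandt_rel \<eta>)"
proof -
  interpret faithful_rep M \<eta> by fact
  note carr = brandt_carrier_iff
  have mult: "Some (i, m, j) \<cdot>\<^bsub>brandt r M\<^esub> Some (k, p, l) =
      (if j = k \<and> m \<cdot>\<^bsub>M\<^esub> p \<noteq> szero M then Some (i, m \<cdot>\<^bsub>M\<^esub> p, l) else None)"
    "None \<cdot>\<^bsub>brandt r M\<^esub> s = None" "s \<cdot>\<^bsub>brandt r M\<^esub> None = None" for i m j k p l s
    by (auto simp: brandt_def split: option.splits)
  have rel: "brandt_rel \<eta> None = {}"
    "brandt_rel \<eta> (Some (i, m, j)) = {((i, y), (j, x)) | y x. (y, x) \<in> \<eta> m}" for i m j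
    by (simp_all add: brandt_rel_def)
  have empty: "u = None" if u: "u \<in> carrier (brandt r M)" "brandt_rel \<eta> u = {}" for u
  proof (rule ccontr)
    assume "u \<noteq> None"
    then obtain i m j where m: "u = Some (i, m, j)" "m \<in> carrier M" "m \<noteq> szero M"
      using u(1) unfolding carr by blast
    then have "\<eta> m \<noteq> {}" using rep_empty_iff by simp
    then show False using u(2) m(1) by (auto simp: rel)
  qed
  show ?thesis
  proof
    show "inj_on (brandt_rel \<eta>) (carrier (brandt r M))"
    proof (rule inj_onI)
      fix s t assume s: "s \<in> carrier (brandt r M)" and t: "t \<in> carrier (brandt r M)"
        and eq: "brandt_rel \<eta> s = brandt_rel \<eta> t"
      show "s = t"
      proof (cases "brandt_rel \<eta> s = {}")
        case True
        then show ?thesis using empty s t eq by metis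
      next
        case False
        then have "s \<noteq> None" "t \<noteq> None" using eq rel(1) by metis+
        then obtain i m j k p l where st: "s = Some (i, m, j)" "t = Some (k, p, l)"
          "m \<in> carrier M" "p \<in> carrier M"
          using s t unfolding carr by blast
        have *: "\<eta> m = {(y, x). ((i, y), (j, x)) \<in> brandt_rel \<eta> s}"
          "\<eta> p = {(y, x). ((k, y), (l, x)) \<in> brandt_rel \<eta> t}"
          by (auto simp: st rel)
        obtain y x where "(y, x) \<in> \<eta> m" using False by (auto simp: st rel)
        then have "((i, y), (j, x)) \<in> brandt_rel \<eta> t" unfolding eq[symmetric] by (auto simp: st rel)
        then have "i = k \<and> j = l" by (auto simp: st rel)
        then have "\<eta> m = \<eta> p" using * eq by simp
        then show ?thesis using st \<open>i = k \<and> j = l\<close> rep_eq_iff by simp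
      qed
    qed
    fix s t assume s: "s \<in> carrier (brandt r M)" and t: "t \<in> carrier (brandt r M)"
    have "s \<cdot>\<^bsub>brandt r M\<^esub> t \<in> carrier (brandt r M) \<and>
      brandt_rel \<eta> (s \<cdot>\<^bsub>brandt r M\<^esub> t) = brandt_rel \<eta> s O brandt_rel \<eta> t"
    proof (cases "s = None \<or> t = None")
      case True
      then have "s \<cdot>\<^bsub>brandt r M\<^esub> t = None" using mult by metis
      moreover have "brandt_rel \<eta> s O brandt_rel \<eta> t = {}" using True rel(1) by auto
      ultimately show ?thesis by (simp add: rel carr)
    next
      case False
      then obtain i m j k p l where st: "s = Some (i, m, j)" "t = Some (k, p, l)"
        "m \<in> carrier M" "p \<in> carrier M" "i \<in> {1..r}" "l \<in> {1..r}"
        using s t unfolding carr by blast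
      have "brandt_rel \<eta> s O brandt_rel \<eta> t =
          (if j = k then {((i, y), (l, x)) | y x. (y, x) \<in> \<eta> m O \<eta> p} else {})"
        unfolding st rel by (auto simp: relcomp_unfold)
      moreover have "\<eta> m O \<eta> p = \<eta> (m \<cdot>\<^bsub>M\<^esub> p)" using st rep_mult by simp
      ultimately show ?thesis using st(5,6) mult_closed[OF st(3,4)] by (simp add: st(1,2) mult rel carr rep_zero)
    qed
    then show "s \<cdot>\<^bsub>brandt r M\<^esub> t \<in> carrier (brandt r M)"
      "brandt_rel \<eta> (s \<cdot>\<^bsub>brandt r M\<^esub> t) = brandt_rel \<eta> s O brandt_rel \<eta> t" by simp_all
  qed (auto simp: brandt_def rel)
qed

lemma ext_polycyclic_rep:
  "relation_rep (ext_polycyclic n r) (brandt_rel (\<lambda>U. \<Union>(word0_rel {1..n} ` U)))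
     (basics {1..r} {1..n})"
proof -
  let ?A = "{1..n}" and ?X = "{1..r}"
  let ?\<eta> = "\<lambda>U. \<Union>(word0_rel ?A ` U)"
  interpret M: faithful_rep "polycyclic n" ?\<eta> by (rule polycyclic_faithful_rep)
  interpret faithful_rep "ext_polycyclic n r" "brandt_rel ?\<eta>"
    unfolding ext_polycyclic_def by (rule brandt_faithful_rep) (rule polycyclic_faithful_rep)
  \<comment> \<open>Adding the indices to a prefix replacement gives a \<open>basic\<close>
    relation, which identifies the image with \<open>basics\<close>.\<close>
  have lift: "{((i, v), (j, u)) | v u. (v, u) \<in> prefix_rel ?A y x} = basic ?A (i, y) (j, x)"
    for i j :: nat and y x
    by (auto simp: prefix_rel_def basic_def ract_def)
  show ?thesis
  proof
    show "brandt_rel ?\<eta> ` carrier (ext_polycyclic n r) = basics ?X ?A"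
    proof (intro equalityI subsetI)
      fix f assume "f \<in> brandt_rel ?\<eta> ` carrier (ext_polycyclic n r)"
      then obtain s where s: "s \<in> carrier (ext_polycyclic n r)" "f = brandt_rel ?\<eta> s" by blast
      show "f \<in> basics ?X ?A"
      proof (cases s)
        case (Some imj)
        then obtain i m j where imj: "s = Some (i, m, j)" "i \<in> ?X" "j \<in> ?X"
          "m \<in> carrier (polycyclic n)" "m \<noteq> szero (polycyclic n)"
          using s unfolding ext_polycyclic_def brandt_carrier_iff by blast
        then have "?\<eta> m \<noteq> {}" using M.rep_empty_iff[of m] by blast
        moreover have "?\<eta> m \<in> insert {} {prefix_rel ?A y x | y x. y \<in> lists ?A \<and> x \<in> lists ?A}"
          unfolding polycyclic_faithful_rep(2)[symmetric] using imj(4) by (rule imageI)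
        ultimately obtain y x where yx: "y \<in> lists ?A" "x \<in> lists ?A" "?\<eta> m = prefix_rel ?A y x"
          by blast
        then have "f = basic ?A (i, y) (j, x)"
          by (simp only: s imj brandt_rel_def option.case prod.case lift)
        then show ?thesis using yx imj by (auto intro!: basics_basic)
      qed (simp add: s basics_empty brandt_rel_def)
    next
      fix f assume "f \<in> basics ?X ?A"
      then show "f \<in> brandt_rel ?\<eta> ` carrier (ext_polycyclic n r)"
      proof (cases rule: basics_cases)
        case 1
        then show ?thesis
          using rep_zero zero_closed by (intro image_eqI[of _ _ "szero (ext_polycyclic n r)"]) simp_all
      next
        case (2 q p)
        obtain i y j x where qp: "q = (i, y)" "p = (j, x)" by (metis surj_pair)
        then have "prefix_rel ?A y x \<in> ?\<eta> ` carrier (polycyclic n)"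
          unfolding polycyclic_faithful_rep(2) using 2 by blast
        then obtain m where m: "m \<in> carrier (polycyclic n)" "?\<eta> m = prefix_rel ?A y x"
          by (metis (no_types, lifting) imageE)
        have "m \<noteq> szero (polycyclic n)"
          using m M.rep_zero prefix_rel_nonempty by (metis empty_iff)
        then have "Some (i, m, j) \<in> carrier (ext_polycyclic n r)"
          using 2 qp m by (simp add: ext_polycyclic_def brandt_def)
        moreover have "f = brandt_rel ?\<eta> (Some (i, m, j))"
          by (simp only: 2 qp m brandt_rel_def option.case prod.case lift)
        ultimately show ?thesis by blast
      qed
    qed
  qed (simp_all add: basics_biunique basics_converse basics_inter)
qed

section \<open>Essential isomorphisms and their maximal extensions\<close>

lemma partial_unions_converse:
  assumes "\<And>f. f \<in> B \<Longrightarrow> f\<inverse> \<in> B" "f \<in> partial_unions B"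
  shows "f\<inverse> \<in> partial_unions B"
proof -
  obtain K where K: "finite K" "K \<subseteq> B" "biunique (\<Union>K)" "f = \<Union>K"
    using assms(2) unfolding partial_unions_def by blast
  have "f\<inverse> = \<Union>(converse ` K)" using K(4) by auto
  moreover have "finite (converse ` K)" "converse ` K \<subseteq> B" using K(1,2) assms(1) by auto
  moreover have "biunique (f\<inverse>)" using K by (simp add: biunique_converse)
  ultimately show ?thesis unfolding partial_unions_def by (intro CollectI exI[of _ "converse ` K"]) simp
qed

definition graph_rel :: "('p \<rightharpoonup> 'p) \<Rightarrow> ('p \<times> 'p) set" where
  "graph_rel f = {(q, p). f p = Some q}"

lemma graph_rel_iff [simp]: "(q, p) \<in> graph_rel f \<longleftrightarrow> f p = Some q"
  by (simp add: graph_rel_def)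

lemma graph_rel_subset_iff: "graph_rel f \<subseteq> graph_rel g \<longleftrightarrow> f \<subseteq>\<^sub>m g"
  by (fastforce simp: map_le_def graph_rel_def dom_def)

lemma graph_rel_inject [simp]: "graph_rel f = graph_rel g \<longleftrightarrow> f = g"
  by (metis graph_rel_subset_iff map_le_antisym order_refl)

text \<open>The value stands first in a pair, so the order of composition is kept; in return
  \<open>Range\<close> is the domain of definition and \<open>Domain\<close> the set of
  values.\<close>

lemma graph_rel_comp: "graph_rel (f \<circ>\<^sub>m g) = graph_rel f O graph_rel g"
  by (auto simp: graph_rel_def map_comp_def split: option.splits)

lemma Range_graph_rel: "Range (graph_rel f) = dom f"
  and Domain_graph_rel: "Domain (graph_rel f) = ran f"
  by (auto simp: graph_rel_def ran_def)

lemma graph_rel_surj: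
  assumes "biunique R"
  obtains f where "graph_rel f = R"
proof
  define f where "f p = (if \<exists>q. (q, p) \<in> R then Some (THE q. (q, p) \<in> R) else None)" for p
  have the: "(THE q. (q, p) \<in> R) = q" if "(q, p) \<in> R" for q p
    using that biunique_left[OF assms] by blast
  show "graph_rel f = R"
  proof (intro equalityI subrelI)
    fix q p assume "(q, p) \<in> graph_rel f"
    then obtain q' where "(q', p) \<in> R" "q = (THE q. (q, p) \<in> R)"
      by (auto simp: f_def split: if_splits)
    then show "(q, p) \<in> R" using the by simp
  next
    fix q p assume "(q, p) \<in> R"
    then show "(q, p) \<in> graph_rel f" using the by (auto simp: f_def)
  qed
qed

lemma biunique_graph_rel_iff: "biunique (graph_rel f) \<longleftrightarrow> inj_on f (dom f)"
  by (auto simp: biunique_def single_valued_def inj_on_def dom_def)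

section \<open>Finitely generated subacts\<close>

lemma fg_subact_empty: "fg_subact X A {}"
  unfolding fg_subact_def by (intro exI[of _ "{}"]) simp

lemma fg_subact_cyclic: "p \<in> X \<times> lists A \<Longrightarrow> fg_subact X A (ract p ` lists A)"
  unfolding fg_subact_def by (intro exI[of _ "{p}"]) simp

lemma fg_subact_Un:
  assumes "fg_subact X A Y" "fg_subact X A Z"
  shows "fg_subact X A (Y \<union> Z)"
proof -
  obtain F G where "finite F" "F \<subseteq> X \<times> lists A" "Y = (\<Union>p\<in>F. ract p ` lists A)"
    "finite G" "G \<subseteq> X \<times> lists A" "Z = (\<Union>p\<in>G. ract p ` lists A)"
    using assms unfolding fg_subact_def by blast
  then show ?thesis
    unfolding fg_subact_def by (intro exI[of _ "F \<union> G"]) simp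
qed

lemma fg_subact_Range:
  assumes "f \<in> partial_unions (basics X A)"
  shows "fg_subact X A (Range f)"
proof -
  obtain K where K: "finite K" "K \<subseteq> basics X A" "f = \<Union>K"
    using assms unfolding partial_unions_def by blast
  from K(1,2) have "fg_subact X A (Range (\<Union>K))"
  proof (induction K rule: finite_induct)
    case (insert k K)
    have "fg_subact X A (Range k)"
      using insert.prems
    proof (elim insert_subset[THEN iffD1, elim_format] conjE basics_cases)
      fix q p assume "p \<in> X \<times> lists A" "k = basic A q p"
      moreover have "Range (basic A q p) = ract p ` lists A"
        by (simp add: basic_def Range_snd image_image)
      ultimately show ?thesis by (simp add: fg_subact_cyclic)
    qed (simp add: fg_subact_empty)
    then show ?case using insert by (simp add: Range_Un_eq fg_subact_Un)
  qed (simp add: fg_subact_empty)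
  then show ?thesis using K(3) by simp
qed

lemma fg_subact_Domain:
  assumes "f \<in> partial_unions (basics X A)"
  shows "fg_subact X A (Domain f)"
  using fg_subact_Range[OF partial_unions_converse[OF basics_converse assms]] by simp

text \<open>By equivariance \<open>f\<close> is determined by its values on generators of its set of
  arguments; each generator contributes one \<open>basic\<close> relation.\<close>

lemma partial_unions_basicsI:
  assumes f: "biunique f" "act_rel X A f" and fg: "fg_subact X A (Range f)"
  shows "f \<in> partial_unions (basics X A)"
proof -
  obtain F where F: "finite F" "F \<subseteq> X \<times> lists A" "Range f = (\<Union>p\<in>F. ract p ` lists A)"
    using fg unfolding fg_subact_def by blast
  define K where "K = (\<lambda>(q, p). basic A q p) ` (f \<inter> UNIV \<times> F)"
  \<comment> \<open>A generator has only one value, so finitely many generators leave finitely many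
    pairs.\<close>
  have "inj_on snd (f \<inter> UNIV \<times> F)"
    using biunique_left[OF f(1)] by (auto simp: inj_on_def)
  moreover have "finite (snd ` (f \<inter> UNIV \<times> F))"
    using F(1) by (rule finite_subset[rotated]) auto
  ultimately have "finite K"
    unfolding K_def by (intro finite_imageI) (rule finite_imageD)
  moreover have "K \<subseteq> basics X A"
  proof
    fix k assume "k \<in> K"
    then obtain q p where "(q, p) \<in> f" "k = basic A q p" unfolding K_def by auto
    then show "k \<in> basics X A" using act_relD(1,2)[OF f(2)] by (simp only: basics_basic)
  qed
  moreover have "f = \<Union>K"
  proof (intro equalityI subrelI)
    fix q p' assume qp': "(q, p') \<in> f"
    then obtain p v where p: "p \<in> F" "v \<in> lists A" "p' = ract p v" using F(3) by blast
    have "ract p [] \<in> Range f" unfolding F(3) using p(1) by blast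
    then obtain q' where q': "(q', p) \<in> f" by auto
    then have "(ract q' v, ract p v) \<in> f" using act_relD(3)[OF f(2)] p(2) by blast
    then have "q = ract q' v" using qp' p(3) biunique_left[OF f(1)] by blast
    then have "(q, p') \<in> basic A q' p" unfolding p(3) using basicI[OF p(2), of q' p] by simp
    moreover have "basic A q' p \<in> K"
      unfolding K_def using q' p(1) by (intro image_eqI[of _ _ "(q', p)"]) simp_all
    ultimately show "(q, p') \<in> \<Union>K" by blast
  next
    fix q p assume "(q, p) \<in> \<Union>K"
    then obtain q' p' where "(q', p') \<in> f" "(q, p) \<in> basic A q' p'" unfolding K_def by auto
    then show "(q, p) \<in> f" using act_relD(3)[OF f(2)] by (elim basicE) simp
  qed
  ultimately show ?thesis
    using f(1) unfolding partial_unions_def by (intro CollectI exI[of _ K]) simp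
qed

section \<open>Essential subacts\<close>

definition essential_set :: "'x set \<Rightarrow> 'a set \<Rightarrow> ('x \<times> 'a list) set \<Rightarrow> bool" where
  "essential_set X A Y \<longleftrightarrow> (\<forall>p\<in>X \<times> lists A. \<exists>v\<in>lists A. ract p v \<in> Y)"

lemma essential_setD:
  assumes "essential_set X A Y" "p \<in> X \<times> lists A"
  obtains v where "v \<in> lists A" "ract p v \<in> Y"
  using assms unfolding essential_set_def by blast

lemma essential_RangeE:
  assumes "essential_set X A (Range f)" "p \<in> X \<times> lists A"
  obtains v q where "v \<in> lists A" "(q, ract p v) \<in> f"
  using essential_setD[OF assms] by (metis RangeE)

lemma essential_DomainE:
  assumes "essential_set X A (Domain f)" "q \<in> X \<times> lists A"
  obtains v p where "v \<in> lists A" "(ract q v, p) \<in> f"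
  using essential_setD[OF assms] by (metis DomainE)

lemma essential_subact_iff:
  "essential_subact X A Y \<longleftrightarrow> subact X A Y \<and> essential_set X A Y"
proof (cases "subact X A Y")
  case True
  have "essential_set X A Y" if Y: "\<forall>Z. subact X A Z \<longrightarrow> Z \<noteq> {} \<longrightarrow> Y \<inter> Z \<noteq> {}"
    unfolding essential_set_def
  proof
    fix p assume p: "p \<in> X \<times> lists A"
    have "subact X A (ract p ` lists A)"
      unfolding subact_def
    proof (intro conjI subsetI ballI)
      fix z assume "z \<in> ract p ` lists A"
      then show "z \<in> X \<times> lists A" using p by (elim imageE) (simp only: ract_in_iff)
    next
      fix z v assume "z \<in> ract p ` lists A" "v \<in> lists A"
      then show "ract z v \<in> ract p ` lists A"
        by (elim imageE) (metis append_in_lists_conv image_eqI ract_ract)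
    qed
    moreover have "ract p ` lists A \<noteq> {}" by blast
    ultimately have "Y \<inter> ract p ` lists A \<noteq> {}" using Y by blast
    then show "\<exists>v\<in>lists A. ract p v \<in> Y" by blast
  qed
  moreover have "Y \<inter> Z \<noteq> {}" if Y: "essential_set X A Y" and Z: "subact X A Z" "Z \<noteq> {}" for Z
  proof -
    obtain z where z: "z \<in> Z" using Z(2) by blast
    then have "z \<in> X \<times> lists A" using Z(1) unfolding subact_def by blast
    then obtain v where "v \<in> lists A" "ract z v \<in> Y" using essential_setD[OF Y] by blast
    moreover have "ract z v \<in> Z" using z Z(1) \<open>v \<in> lists A\<close> unfolding subact_def by blast
    ultimately show ?thesis by blast
  qed
  ultimately show ?thesis unfolding essential_subact_def using True by blast
qed (simp add: essential_subact_def)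

text \<open>An essential finitely generated subact contains all sufficiently long words, so a larger subact
  needs only finitely many further generators.\<close>

lemma fg_subact_superset:
  assumes fin: "finite X" "finite A" and Y: "fg_subact X A Y" "essential_set X A Y"
    and Z: "subact X A Z" "Y \<subseteq> Z"
  shows "fg_subact X A Z"
proof -
  obtain F where F: "finite F" "F \<subseteq> X \<times> lists A" "Y = (\<Union>p\<in>F. ract p ` lists A)"
    using Y(1) unfolding fg_subact_def by blast
  \<comment> \<open>The greatest length of a generator; the inserted 0 keeps \<open>Max\<close>
    defined when \<open>F\<close> is empty.\<close>
  define N where "N = Max (insert 0 ((length \<circ> snd) ` F))"
  have N: "length (snd g) \<le> N" if "g \<in> F" for g
    using F(1) that unfolding N_def by (intro Max_ge) auto
  have "Z - Y \<subseteq> X \<times> {w. set w \<subseteq> A \<and> length w \<le> N}"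
  proof
    fix p assume p: "p \<in> Z - Y"
    then have pW: "p \<in> X \<times> lists A" using Z(1) unfolding subact_def by blast
    have "length (snd p) \<le> N"
    proof (rule ccontr)
      assume long: "\<not> length (snd p) \<le> N"
      obtain v where "v \<in> lists A" "ract p v \<in> Y" using essential_setD[OF Y(2) pW] .
      then obtain g w where g: "g \<in> F" "w \<in> lists A" "ract p v = ract g w"
        unfolding F(3) by blast
      from g(3) show False
      proof (cases rule: ract_eq_cases)
        case (1 z)
        then have "p \<in> ract g ` lists A" using g(2) by simp
        then show False using p g(1) unfolding F(3) by blast
      next
        case (2 z)
        then have "length (snd p) \<le> length (snd g)" by (simp add: ract_def)
        then show False using N[OF g(1)] long by simp
      qed
    qed
    then show "p \<in> X \<times> {w. set w \<subseteq> A \<and> length w \<le> N}" using pW by (auto simp: mem_Times_iff)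
  qed
  then have "finite (Z - Y)"
    by (rule finite_subset) (intro finite_cartesian_product finite_lists_length_le fin)
  moreover have "F \<subseteq> Y"
  proof
    fix p assume "p \<in> F"
    then have "ract p [] \<in> Y" unfolding F(3) by blast
    then show "p \<in> Y" by simp
  qed
  moreover have "Z = (\<Union>p\<in>F \<union> (Z - Y). ract p ` lists A)"
  proof (intro equalityI subsetI)
    fix z assume z: "z \<in> Z"
    show "z \<in> (\<Union>p\<in>F \<union> (Z - Y). ract p ` lists A)"
    proof (cases "z \<in> Y")
      case False
      then show ?thesis using z by (intro UN_I[of z] image_eqI[of _ _ "[]"]) simp_all
    qed (simp add: F(3))
  next
    fix z assume "z \<in> (\<Union>p\<in>F \<union> (Z - Y). ract p ` lists A)"
    then obtain p v where "p \<in> F \<union> (Z - Y)" "v \<in> lists A" "z = ract p v" by blast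
    then show "z \<in> Z" using Z \<open>F \<subseteq> Y\<close> unfolding subact_def by blast
  qed
  moreover have "F \<union> (Z - Y) \<subseteq> X \<times> lists A"
    using F(2) Z(1) unfolding subact_def by blast
  ultimately show ?thesis
    unfolding fg_subact_def using F(1) by (intro exI[of _ "F \<union> (Z - Y)"]) simp
qed

definition ess_rels :: "'x set \<Rightarrow> 'a set \<Rightarrow> (('x \<times> 'a list) \<times> ('x \<times> 'a list)) set set" where
  "ess_rels X A = {f \<in> partial_unions (basics X A).
     essential_set X A (Domain f) \<and> essential_set X A (Range f)}"

lemma partial_unions_biunique: "f \<in> partial_unions B \<Longrightarrow> biunique f"
  unfolding partial_unions_def by blast

lemma ess_relsD:
  assumes "f \<in> ess_rels X A"
  shows "f \<in> partial_unions (basics X A)" "biunique f" "act_rel X A f"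
    "essential_set X A (Domain f)" "essential_set X A (Range f)"
  using assms partial_unions_biunique partial_unions_act_rel unfolding ess_rels_def by blast+

lemma act_rel_subact:
  assumes "act_rel X A f"
  shows "subact X A (Domain f)" "subact X A (Range f)"
  unfolding subact_def using assms unfolding act_rel_def by blast+

text \<open>Finite generation of the domain makes an equivariant injection a finite union of
  \<open>basic\<close> relations; from such a union finite generation on both sides is
  recovered.\<close>

lemma ess_isos_iff: "f \<in> ess_isos X A \<longleftrightarrow> graph_rel f \<in> ess_rels X A"
proof
  assume f: "f \<in> ess_isos X A"
  have fg: "fg_subact X A (dom f)" and inj: "inj_on f (dom f)"
    and eq: "\<forall>p\<in>dom f. \<forall>v\<in>lists A. f (ract p v) = map_option (\<lambda>q. ract q v) (f p)"
    and dom: "essential_subact X A (dom f)" and ran: "essential_subact X A (ran f)"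
    using f unfolding ess_isos_def by blast+
  have "graph_rel f \<subseteq> (X \<times> lists A) \<times> (X \<times> lists A)"
  proof (rule subrelI)
    fix q p assume "(q, p) \<in> graph_rel f"
    then have "q \<in> ran f" "p \<in> dom f" by (auto intro: ranI)
    then show "(q, p) \<in> (X \<times> lists A) \<times> (X \<times> lists A)"
      using dom ran unfolding essential_subact_def subact_def by blast
  qed
  moreover have "(ract q v, ract p v) \<in> graph_rel f"
    if "(q, p) \<in> graph_rel f" "v \<in> lists A" for q p v
  proof -
    have "f p = Some q" using that(1) by simp
    then show ?thesis using eq that(2) by (simp add: domI)
  qed
  ultimately have "act_rel X A (graph_rel f)" unfolding act_rel_def by blast
  then have "graph_rel f \<in> partial_unions (basics X A)"
    using fg inj by (intro partial_unions_basicsI) (simp_all add: biunique_graph_rel_iff Range_graph_rel)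
  then show "graph_rel f \<in> ess_rels X A"
    using dom ran by (simp add: ess_rels_def essential_subact_iff Range_graph_rel Domain_graph_rel)
next
  assume f: "graph_rel f \<in> ess_rels X A"
  have eq: "f (ract p v) = map_option (\<lambda>q. ract q v) (f p)" if p: "p \<in> dom f" and v: "v \<in> lists A" for p v
  proof -
    obtain q where "f p = Some q" using p by blast
    then show ?thesis using act_relD(3)[OF ess_relsD(3)[OF f], of q p v] v by simp
  qed
  have "inj_on f (dom f)" using ess_relsD(2)[OF f] by (simp add: biunique_graph_rel_iff)
  moreover have "fg_subact X A (dom f)" "fg_subact X A (ran f)"
    using fg_subact_Range[OF ess_relsD(1)[OF f]] fg_subact_Domain[OF ess_relsD(1)[OF f]]
    by (simp_all add: Range_graph_rel Domain_graph_rel)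
  moreover have "essential_subact X A (dom f)" "essential_subact X A (ran f)"
    using act_rel_subact[OF ess_relsD(3)[OF f]] ess_relsD(4,5)[OF f]
    by (simp_all add: essential_subact_iff Range_graph_rel Domain_graph_rel)
  ultimately show "f \<in> ess_isos X A"
    unfolding ess_isos_def using eq by blast
qed

section \<open>The largest equivalent relation\<close>

definition max_ext :: "'x set \<Rightarrow> 'a set \<Rightarrow> (('x \<times> 'a list) \<times> ('x \<times> 'a list)) set
    \<Rightarrow> (('x \<times> 'a list) \<times> ('x \<times> 'a list)) set" where
  "max_ext X A f = {(q, p). q \<in> X \<times> lists A \<and> p \<in> X \<times> lists A \<and>
     (\<forall>v\<in>lists A. \<exists>w\<in>lists A. (ract q (v @ w), ract p (v @ w)) \<in> f)}"

lemma max_extD: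
  assumes "(q, p) \<in> max_ext X A f" "v \<in> lists A"
  obtains w where "w \<in> lists A" "(ract q (v @ w), ract p (v @ w)) \<in> f"
  using assms unfolding max_ext_def by blast

lemma act_rel_max_ext: "act_rel X A (max_ext X A f)"
  unfolding act_rel_def
proof (intro conjI allI impI)
  show "max_ext X A f \<subseteq> (X \<times> lists A) \<times> (X \<times> lists A)"
    unfolding max_ext_def by blast
  fix q p v assume qp: "(q, p) \<in> max_ext X A f" and v: "v \<in> lists A"
  have "\<exists>w\<in>lists A. (ract (ract q v) (u @ w), ract (ract p v) (u @ w)) \<in> f" if "u \<in> lists A" for u
    using max_extD[OF qp, of "v @ u"] v that by (metis append.assoc append_in_lists_conv ract_ract)
  moreover have "ract q v \<in> X \<times> lists A" "ract p v \<in> X \<times> lists A"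
    using qp v unfolding ract_in_iff by (simp_all add: max_ext_def)
  ultimately show "(ract q v, ract p v) \<in> max_ext X A f"
    unfolding max_ext_def by blast
qed

lemma dense_in_max_ext: "dense_in (basics X A) (max_ext X A f) f"
  unfolding dense_in_basics_iff[OF act_rel_max_ext]
proof (intro allI impI)
  fix q p assume "(q, p) \<in> max_ext X A f"
  from max_extD[OF this, of "[]"] show "\<exists>v\<in>lists A. (ract q v, ract p v) \<in> f" by auto
qed

lemma dense_in_basicsD:
  assumes "act_rel X A f" "dense_in (basics X A) f g" "(q, p) \<in> f"
  obtains v where "v \<in> lists A" "(ract q v, ract p v) \<in> g"
  using assms(2,3) that unfolding dense_in_basics_iff[OF assms(1)] by blast

text \<open>The action keeps every extension of a pair inside \<open>g\<close>, and density then
  leads it into \<open>f\<close>; this is the condition for every \<open>v\<close> in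
  \<open>max_ext\<close>.\<close>

lemma subset_max_ext:
  assumes g: "act_rel X A g" and dense: "dense_in (basics X A) g f"
  shows "g \<subseteq> max_ext X A f"
proof (rule subrelI)
  fix q p assume qp: "(q, p) \<in> g"
  have "\<exists>w\<in>lists A. (ract q (v @ w), ract p (v @ w)) \<in> f" if "v \<in> lists A" for v
    using dense_in_basicsD[OF g dense act_relD(3)[OF g qp that]] by (metis ract_ract)
  then show "(q, p) \<in> max_ext X A f"
    using act_relD(1,2)[OF g qp] unfolding max_ext_def by blast
qed

text \<open>Two pairs with a common entry can be pushed into \<open>f\<close> by one and the same
  word; there two-sided uniqueness applies, and the word cancels.\<close>

lemma biunique_max_ext:
  assumes "biunique f" "act_rel X A f"
  shows "biunique (max_ext X A f)"
proof (rule biuniqueI)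
  fix q p p' assume 1: "(q, p) \<in> max_ext X A f" and 2: "(q, p') \<in> max_ext X A f"
  obtain w where w: "w \<in> lists A" "(ract q w, ract p w) \<in> f"
    using max_extD[OF 1, of "[]"] by auto
  \<comment> \<open>The quantifier over all \<open>v\<close> is taken at \<open>w\<close>, so the
    second pair enters \<open>f\<close> beyond \<open>w\<close>, where the action keeps the first
    pair.\<close>
  obtain u where u: "u \<in> lists A" "(ract q (w @ u), ract p' (w @ u)) \<in> f"
    using max_extD[OF 2 w(1)] .
  have "(ract q (w @ u), ract p (w @ u)) \<in> f"
    using act_relD(3)[OF assms(2) w(2) u(1)] by simp
  then have "ract p (w @ u) = ract p' (w @ u)"
    using u(2) biunique_right[OF assms(1)] by blast
  then show "p = p'" by simp
next
  fix q q' p assume 1: "(q, p) \<in> max_ext X A f" and 2: "(q', p) \<in> max_ext X A f"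
  obtain w where w: "w \<in> lists A" "(ract q w, ract p w) \<in> f"
    using max_extD[OF 1, of "[]"] by auto
  obtain u where u: "u \<in> lists A" "(ract q' (w @ u), ract p (w @ u)) \<in> f"
    using max_extD[OF 2 w(1)] .
  have "(ract q (w @ u), ract p (w @ u)) \<in> f"
    using act_relD(3)[OF assms(2) w(2) u(1)] by simp
  then have "ract q (w @ u) = ract q' (w @ u)"
    using u(2) biunique_left[OF assms(1)] by blast
  then show "q = q'" by simp
qed

lemma essential_set_mono: "essential_set X A Y \<Longrightarrow> Y \<subseteq> Z \<Longrightarrow> essential_set X A Z"
  unfolding essential_set_def by blast

lemma max_ext_superset: "act_rel X A f \<Longrightarrow> f \<subseteq> max_ext X A f"
  by (simp add: subset_max_ext dense_in_subset)

lemma max_ext_ess_rels: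
  assumes fin: "finite X" "finite A" and f: "f \<in> ess_rels X A"
  shows "max_ext X A f \<in> ess_rels X A"
proof -
  note f' = ess_relsD[OF f]
  have sub: "f \<subseteq> max_ext X A f" by (rule max_ext_superset[OF f'(3)])
  have dom: "Domain f \<subseteq> Domain (max_ext X A f)" and ran: "Range f \<subseteq> Range (max_ext X A f)"
    using sub by blast+
  have "fg_subact X A (Range (max_ext X A f))"
    using fg_subact_superset[OF fin fg_subact_Range[OF f'(1)] f'(5)
        act_rel_subact(2)[OF act_rel_max_ext] ran] .
  then have "max_ext X A f \<in> partial_unions (basics X A)"
    by (intro partial_unions_basicsI biunique_max_ext f' act_rel_max_ext)
  then show ?thesis
    using essential_set_mono[OF f'(4) dom] essential_set_mono[OF f'(5) ran]
    by (simp add: ess_rels_def)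
qed

lemma codense_max_ext:
  assumes "act_rel X A f"
  shows "codense (basics X A) (max_ext X A f) f"
  using dense_in_max_ext dense_in_subset[OF max_ext_superset[OF assms]]
  by (simp add: codense_def)

text \<open>An extension leading into one relation can be prolonged into the other by density, so
  the two defining conditions agree.\<close>

lemma max_ext_cong:
  assumes "act_rel X A f" "act_rel X A g" "codense (basics X A) f g"
  shows "max_ext X A f = max_ext X A g"
proof -
  have sub: "max_ext X A u \<subseteq> max_ext X A v"
    if u: "act_rel X A u" and uv: "dense_in (basics X A) u v"
    for u v :: "(('a \<times> 'b list) \<times> 'a \<times> 'b list) set"
  proof (rule subrelI)
    fix q p assume qp: "(q, p) \<in> max_ext X A u"
    have "\<exists>w\<in>lists A. (ract q (x @ w), ract p (x @ w)) \<in> v" if x: "x \<in> lists A" for x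
    proof -
      obtain w where w: "w \<in> lists A" "(ract q (x @ w), ract p (x @ w)) \<in> u"
        using max_extD[OF qp x] .
      obtain w' where "w' \<in> lists A"
        "(ract (ract q (x @ w)) w', ract (ract p (x @ w)) w') \<in> v"
        using dense_in_basicsD[OF u uv w(2)] .
      then show ?thesis using w(1) by (intro bexI[of _ "w @ w'"]) simp_all
    qed
    then show "(q, p) \<in> max_ext X A v"
      using qp unfolding max_ext_def by blast
  qed
  show ?thesis
    using sub[OF assms(1)] sub[OF assms(2)] assms(3) unfolding codense_def by blast
qed

text \<open>Every argument of \<open>g\<close> has an extension at which \<open>f\<close> is
  defined, because the domain of \<open>f\<close> is essential; there the inclusion forces both
  values to agree.\<close>

lemma ess_rels_subset_codense:
  assumes f: "f \<in> ess_rels X A" and g: "g \<in> ess_rels X A" and sub: "f \<subseteq> g"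
  shows "codense (basics X A) f g"
proof -
  note f' = ess_relsD[OF f] and g' = ess_relsD[OF g]
  have "\<exists>v\<in>lists A. (ract q v, ract p v) \<in> f" if qp: "(q, p) \<in> g" for q p
  proof -
    obtain v where v: "v \<in> lists A" "ract p v \<in> Range f"
      using essential_setD[OF f'(5) act_relD(2)[OF g'(3) qp]] .
    then obtain q' where q': "(q', ract p v) \<in> f" by blast
    moreover have "(ract q v, ract p v) \<in> g" using act_relD(3)[OF g'(3) qp v(1)] .
    ultimately have "q' = ract q v" using sub biunique_left[OF g'(2)] by blast
    then show ?thesis using q' v(1) by blast
  qed
  then show ?thesis
    using dense_in_subset[OF sub] by (simp add: codense_def dense_in_basics_iff[OF g'(3)])
qed

text \<open>Maximality is being a fixed point of \<open>max_ext\<close>. An essential isomorphism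
  above \<open>h\<close> is codense with it, hence has the same \<open>max_ext\<close>, and it is
  contained in that relation.\<close>

lemma max_ess_isos_iff:
  assumes fin: "finite X" "finite A"
  shows "h \<in> max_ess_isos X A \<longleftrightarrow>
    graph_rel h \<in> ess_rels X A \<and> max_ext X A (graph_rel h) = graph_rel h"
proof
  assume h: "h \<in> max_ess_isos X A"
  then have h': "graph_rel h \<in> ess_rels X A" by (simp add: max_ess_isos_def ess_isos_iff)
  have m: "max_ext X A (graph_rel h) \<in> ess_rels X A" by (rule max_ext_ess_rels[OF fin h'])
  obtain k where k: "graph_rel k = max_ext X A (graph_rel h)"
    using graph_rel_surj[OF ess_relsD(2)[OF m]] .
  then have "k \<in> ess_isos X A" "h \<subseteq>\<^sub>m k"
    using m max_ext_superset[OF ess_relsD(3)[OF h']]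
    by (simp_all add: ess_isos_iff flip: graph_rel_subset_iff)
  then have "k = h" using h by (simp add: max_ess_isos_def)
  then show "graph_rel h \<in> ess_rels X A \<and> max_ext X A (graph_rel h) = graph_rel h"
    using h' k by simp
next
  assume h: "graph_rel h \<in> ess_rels X A \<and> max_ext X A (graph_rel h) = graph_rel h"
  have "g = h" if "g \<in> ess_isos X A" "h \<subseteq>\<^sub>m g" for g
  proof -
    have g: "graph_rel g \<in> ess_rels X A" "graph_rel h \<subseteq> graph_rel g"
      using that by (simp_all add: ess_isos_iff graph_rel_subset_iff)
    then have "codense (basics X A) (graph_rel h) (graph_rel g)"
      using h ess_rels_subset_codense by blast
    then have "max_ext X A (graph_rel g) = graph_rel h"
      using max_ext_cong[of X A "graph_rel h" "graph_rel g"] h g(1) ess_relsD(3) by metis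
    then have "graph_rel g \<subseteq> graph_rel h"
      using max_ext_superset[OF ess_relsD(3)[OF g(1)]] by simp
    then show "g = h" using g(2) graph_rel_inject by blast
  qed
  then show "h \<in> max_ess_isos X A"
    using h by (simp add: max_ess_isos_def ess_isos_iff)
qed

lemma max_ess_iso_obtain:
  assumes fin: "finite X" "finite A" and f: "f \<in> ess_rels X A"
  obtains h where "h \<in> max_ess_isos X A" "graph_rel h = max_ext X A f"
proof -
  have m: "max_ext X A f \<in> ess_rels X A" by (rule max_ext_ess_rels[OF fin f])
  obtain h where h: "graph_rel h = max_ext X A f"
    using graph_rel_surj[OF ess_relsD(2)[OF m]] .
  moreover have "max_ext X A (max_ext X A f) = max_ext X A f"
    using max_ext_cong[OF act_rel_max_ext ess_relsD(3)[OF f] codense_max_ext[OF ess_relsD(3)[OF f]]] .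
  ultimately show thesis
    using that m by (simp add: max_ess_isos_iff[OF fin])
qed

text \<open>Resolves the description in the product of \<open>act_HT_group\<close>: a maximal
  isomorphism above \<open>f\<close> is its own \<open>max_ext\<close> and is codense with
  \<open>f\<close>, so it is the \<open>max_ext\<close> of \<open>f\<close>.\<close>

lemma max_extension_eq:
  assumes fin: "finite X" "finite A" and f: "graph_rel f \<in> ess_rels X A"
    and h: "h \<in> max_ess_isos X A" "graph_rel h = max_ext X A (graph_rel f)"
  shows "(THE h. h \<in> max_ess_isos X A \<and> f \<subseteq>\<^sub>m h) = h"
proof (rule the_equality)
  show "h \<in> max_ess_isos X A \<and> f \<subseteq>\<^sub>m h"
    using h max_ext_superset[OF ess_relsD(3)[OF f]] by (simp flip: graph_rel_subset_iff)
  fix k assume k: "k \<in> max_ess_isos X A \<and> f \<subseteq>\<^sub>m k"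
  then have k': "graph_rel k \<in> ess_rels X A" "max_ext X A (graph_rel k) = graph_rel k"
    "graph_rel f \<subseteq> graph_rel k"
    by (simp_all add: max_ess_isos_iff[OF fin] graph_rel_subset_iff)
  have "max_ext X A (graph_rel f) = max_ext X A (graph_rel k)"
    using max_ext_cong[OF ess_relsD(3)[OF f] ess_relsD(3)[OF k'(1)]
        ess_rels_subset_codense[OF f k'(1,3)]] .
  then have "graph_rel k = graph_rel h" using h(2) k'(2) by simp
  then show "k = h" by simp
qed

section \<open>The group of units\<close>

text \<open>Stated with closure of the multiplication alone, so that the isomorphism can be reversed
  before any group law is established for \<open>act_HT_group\<close>.\<close>

lemma iso_inv_into:
  assumes h: "h \<in> iso G H"
    and closed: "\<And>x y. \<lbrakk>x \<in> carrier G; y \<in> carrier G\<rbrakk> \<Longrightarrow> x \<otimes>\<^bsub>G\<^esub> y \<in> carrier G"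
  shows "inv_into (carrier G) h \<in> iso H G"
proof -
  have hom: "h \<in> hom G H" and bij: "bij_betw h (carrier G) (carrier H)"
    using h by (simp_all add: iso_def)
  let ?k = "inv_into (carrier G) h"
  have "?k \<in> hom H G"
  proof (rule homI)
    fix x assume "x \<in> carrier H"
    then show "?k x \<in> carrier G" using bij by (metis bij_betw_def inv_into_into)
  next
    fix x y assume "x \<in> carrier H" "y \<in> carrier H"
    then obtain a b where ab: "a \<in> carrier G" "b \<in> carrier G" "x = h a" "y = h b"
      using bij unfolding bij_betw_def by blast
    have "x \<otimes>\<^bsub>H\<^esub> y = h (a \<otimes>\<^bsub>G\<^esub> b)" using hom_mult[OF hom ab(1,2)] ab by simp
    then show "?k (x \<otimes>\<^bsub>H\<^esub> y) = ?k x \<otimes>\<^bsub>G\<^esub> ?k y"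
      using ab closed bij by (simp add: bij_betw_def inv_into_f_f)
  qed
  then show ?thesis using bij_betw_inv_into[OF bij] by (simp add: iso_def)
qed

section \<open>The completion as a monoid\<close>

locale act_rep = relation_rep S \<theta> "basics X A"
  for S :: "('s, 'z) semigroup0_scheme" (structure)
    and \<theta> :: "'s \<Rightarrow> (('x \<times> 'a list) \<times> ('x \<times> 'a list)) set"
    and X :: "'x set" and A :: "'a set" +
  assumes finite_X: "finite X" and finite_A: "finite A"
begin

text \<open>\<open>S\<close> is to be instantiated by the quotient by \<leftrightarrow>, for which
  this is the monoid of the distributive completion.\<close>

abbreviation completion :: "'s set set monoid" where
  "completion \<equiv> monoid_of (quotient_semigroup0 (FC S) (FC_rel S))"

abbreviation identity_rel :: "(('x \<times> 'a list) \<times> ('x \<times> 'a list)) set" where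
  "identity_rel \<equiv> Id_on (X \<times> lists A)"

lemma identity_rel_in: "identity_rel \<in> partial_unions (basics X A)"
proof (rule partial_unions_basicsI)
  show "biunique identity_rel" by (rule biuniqueI) auto
  show "act_rel X A identity_rel"
    unfolding act_rel_def by (intro conjI allI impI Id_on_subset_Times) (simp add: Id_on_iff del: mem_Sigma_iff)
  \<comment> \<open>The act is generated by the empty words, one for each element of the finite set
    \<open>X\<close>; this is why the identity belongs to the completion.\<close>
  have "X \<times> lists A = (\<Union>p\<in>X \<times> {[]}. ract p ` lists A)"
    by (auto simp: ract_def image_iff)
  moreover have "Range identity_rel = X \<times> lists A" by auto
  ultimately show "fg_subact X A (Range identity_rel)"
    unfolding fg_subact_def using finite_X by (intro exI[of _ "X \<times> {[]}"]) auto
qed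

lemma identity_rel_comp:
  assumes "f \<in> partial_unions (basics X A)"
  shows "identity_rel O f = f" "f O identity_rel = f"
proof -
  have "f \<subseteq> (X \<times> lists A) \<times> (X \<times> lists A)"
    using partial_unions_act_rel[OF assms] by (simp add: act_rel_def)
  then show "identity_rel O f = f" "f O identity_rel = f" by blast+
qed

lemma completion_carrier: "carrier completion = codense_class ` partial_unions (basics X A)"
  by (simp add: monoid_of_def FC_quotient_carrier)

lemma completion_mult:
  "\<lbrakk>f \<in> partial_unions (basics X A); g \<in> partial_unions (basics X A)\<rbrakk>
    \<Longrightarrow> codense_class f \<otimes>\<^bsub>completion\<^esub> codense_class g = codense_class (f O g)"
  by (simp add: monoid_of_def FC_quotient_mult)

lemma completion_one: "\<one>\<^bsub>completion\<^esub> = codense_class identity_rel"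
proof -
  let ?D = "quotient_semigroup0 (FC S) (FC_rel S)"
  have carr: "carrier ?D = codense_class ` partial_unions (basics X A)"
    by (rule FC_quotient_carrier)
  have left: "smult ?D (codense_class identity_rel) x = x"
    and right: "smult ?D x (codense_class identity_rel) = x" if "x \<in> carrier ?D" for x
    using that identity_rel_in unfolding carr
    by (auto simp: FC_quotient_mult identity_rel_comp)
  have "(THE e. e \<in> carrier ?D \<and> (\<forall>x\<in>carrier ?D. smult ?D e x = x \<and> smult ?D x e = x)) =
      codense_class identity_rel"
  proof (rule the_equality)
    show "codense_class identity_rel \<in> carrier ?D \<and> (\<forall>x\<in>carrier ?D.
        smult ?D (codense_class identity_rel) x = x \<and> smult ?D x (codense_class identity_rel) = x)"
      using left right identity_rel_in unfolding carr by blast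
    fix e assume e: "e \<in> carrier ?D \<and> (\<forall>x\<in>carrier ?D. smult ?D e x = x \<and> smult ?D x e = x)"
    have "codense_class identity_rel \<in> carrier ?D" unfolding carr using identity_rel_in by blast
    then show "e = codense_class identity_rel" using e left[of e] by metis
  qed
  then show ?thesis by (simp add: monoid_of_def)
qed

lemma monoid_completion: "monoid completion"
proof (rule monoidI)
  show "\<one>\<^bsub>completion\<^esub> \<in> carrier completion"
    unfolding completion_one completion_carrier using identity_rel_in by blast
next
  fix x y assume "x \<in> carrier completion" "y \<in> carrier completion"
  then obtain f g where fg: "f \<in> partial_unions (basics X A)" "g \<in> partial_unions (basics X A)"
    "x = codense_class f" "y = codense_class g"
    unfolding completion_carrier by blast
  show "x \<otimes>\<^bsub>completion\<^esub> y \<in> carrier completion"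
    unfolding fg(3,4) completion_mult[OF fg(1,2)] completion_carrier
    using partial_unions_comp[OF fg(1,2)] by blast
next
  fix x y z assume "x \<in> carrier completion" "y \<in> carrier completion" "z \<in> carrier completion"
  then obtain f g h where fgh: "f \<in> partial_unions (basics X A)" "g \<in> partial_unions (basics X A)"
    "h \<in> partial_unions (basics X A)"
    "x = codense_class f" "y = codense_class g" "z = codense_class h"
    unfolding completion_carrier by blast
  then show "x \<otimes>\<^bsub>completion\<^esub> y \<otimes>\<^bsub>completion\<^esub> z = x \<otimes>\<^bsub>completion\<^esub> (y \<otimes>\<^bsub>completion\<^esub> z)"
    by (simp add: completion_mult partial_unions_comp O_assoc)
next
  fix x assume "x \<in> carrier completion"
  then obtain f where f: "f \<in> partial_unions (basics X A)" "x = codense_class f"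
    unfolding completion_carrier by blast
  then show "\<one>\<^bsub>completion\<^esub> \<otimes>\<^bsub>completion\<^esub> x = x" "x \<otimes>\<^bsub>completion\<^esub> \<one>\<^bsub>completion\<^esub> = x"
    by (simp_all add: completion_one completion_mult identity_rel_in identity_rel_comp)
qed

section \<open>Units and their maximal representatives\<close>

lemma essential_set_dense:
  assumes "dense_in (basics X A) identity_rel h"
  shows "essential_set X A (Domain h)" "essential_set X A (Range h)"
proof -
  have "\<exists>v\<in>lists A. (ract p v, ract p v) \<in> h" if "p \<in> X \<times> lists A" for p
    using dense_in_basicsD[OF partial_unions_act_rel[OF identity_rel_in] assms Id_onI[OF that]]
    by blast
  then show "essential_set X A (Domain h)" "essential_set X A (Range h)"
    unfolding essential_set_def by blast+
qed

lemma codense_identity_rel: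
  assumes "h \<subseteq> identity_rel" "essential_set X A (Range h)"
  shows "codense (basics X A) h identity_rel"
proof -
  have "\<exists>v\<in>lists A. (ract q v, ract p v) \<in> h" if "(q, p) \<in> identity_rel" for q p
  proof -
    have qp: "q = p" "p \<in> X \<times> lists A" using that by blast+
    obtain v where v: "v \<in> lists A" "ract p v \<in> Range h" using essential_setD[OF assms(2) qp(2)] .
    then obtain q' where q': "(q', ract p v) \<in> h" by (elim RangeE)
    then have "q' = ract p v" using assms(1) by (auto simp: Id_on_iff)
    then show ?thesis using q' v(1) qp(1) by blast
  qed
  then show ?thesis
    using dense_in_subset[OF assms(1)]
    by (simp add: codense_def dense_in_basics_iff[OF partial_unions_act_rel[OF identity_rel_in]])
qed

text \<open>If \<open>g O f\<close> is codense with the identity, its arguments form an essential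
  set, and they are arguments of \<open>f\<close>; the other product handles the values. Conversely
  \<open>f\<inverse>\<close> gives the inverse, since both composites are identities on essential
  sets.\<close>

lemma Units_completion: "Units completion = codense_class ` ess_rels X A"
proof (intro equalityI subsetI)
  fix u assume "u \<in> Units completion"
  then obtain f g where fg: "f \<in> partial_unions (basics X A)" "g \<in> partial_unions (basics X A)"
    and u: "u = codense_class f"
    and eq: "codense_class g \<otimes>\<^bsub>completion\<^esub> codense_class f = \<one>\<^bsub>completion\<^esub>"
      "codense_class f \<otimes>\<^bsub>completion\<^esub> codense_class g = \<one>\<^bsub>completion\<^esub>"
    unfolding Units_def completion_carrier by blast
  have "codense (basics X A) identity_rel (g O f)" "codense (basics X A) identity_rel (f O g)"
    using eq fg by (simp_all add: completion_mult completion_one codense_class_eq_iff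
        partial_unions_comp identity_rel_in codense_sym)
  then have "essential_set X A (Range (g O f))" "essential_set X A (Domain (f O g))"
    using essential_set_dense unfolding codense_def by blast+
  then have "essential_set X A (Range f)" "essential_set X A (Domain f)"
    using essential_set_mono[of X A "Range (g O f)" "Range f"]
      essential_set_mono[of X A "Domain (f O g)" "Domain f"] by blast+
  then show "u \<in> codense_class ` ess_rels X A"
    using u fg(1) by (simp add: ess_rels_def)
next
  fix u assume "u \<in> codense_class ` ess_rels X A"
  then obtain f where f: "f \<in> ess_rels X A" and u: "u = codense_class f" by blast
  note f' = ess_relsD[OF f]
  have g: "f\<inverse> \<in> partial_unions (basics X A)"
    using partial_unions_converse[OF basics_converse f'(1)] .
  have sub1: "f\<inverse> O f \<subseteq> identity_rel"
  proof (rule subrelI)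
    fix p p' assume "(p, p') \<in> f\<inverse> O f"
    then obtain q where q: "(q, p) \<in> f" "(q, p') \<in> f" by blast
    show "(p, p') \<in> identity_rel"
      using biunique_right[OF f'(2) q] act_relD(2)[OF f'(3) q(1)] by (simp add: Id_on_iff)
  qed
  have sub2: "f O f\<inverse> \<subseteq> identity_rel"
  proof (rule subrelI)
    fix q q' assume "(q, q') \<in> f O f\<inverse>"
    then obtain p where p: "(q, p) \<in> f" "(q', p) \<in> f" by blast
    show "(q, q') \<in> identity_rel"
      using biunique_left[OF f'(2) p] act_relD(1)[OF f'(3) p(1)] by (simp add: Id_on_iff)
  qed
  have "codense (basics X A) (f\<inverse> O f) identity_rel"
    by (rule codense_identity_rel[OF sub1]) (rule essential_set_mono[OF f'(5)], blast)
  moreover have "codense (basics X A) (f O f\<inverse>) identity_rel"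
    by (rule codense_identity_rel[OF sub2]) (rule essential_set_mono[OF f'(4)], blast)
  ultimately have "codense_class (f\<inverse>) \<otimes>\<^bsub>completion\<^esub> codense_class f = \<one>\<^bsub>completion\<^esub>"
    "codense_class f \<otimes>\<^bsub>completion\<^esub> codense_class (f\<inverse>) = \<one>\<^bsub>completion\<^esub>"
    using f'(1) g by (simp_all add: completion_mult completion_one codense_class_eq_iff
        partial_unions_comp identity_rel_in)
  then show "u \<in> Units completion"
    unfolding Units_def completion_carrier u using f'(1) g by blast
qed

text \<open>A point is extended until \<open>g\<close> is defined there, then further until
  \<open>f\<close> is defined at the value; equivariance of \<open>g\<close> carries the second
  extension back to the argument. Values are treated symmetrically.\<close>

lemma ess_rels_comp:
  assumes f: "f \<in> ess_rels X A" and g: "g \<in> ess_rels X A"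
  shows "f O g \<in> ess_rels X A"
proof -
  note f' = ess_relsD[OF f] and g' = ess_relsD[OF g]
  have "essential_set X A (Range (f O g))"
    unfolding essential_set_def
  proof
    fix p assume "p \<in> X \<times> lists A"
    then obtain v m where v: "v \<in> lists A" "(m, ract p v) \<in> g"
      by (rule essential_RangeE[OF g'(5)])
    obtain w q where w: "w \<in> lists A" "(q, ract m w) \<in> f"
      using essential_RangeE[OF f'(5) act_relD(1)[OF g'(3) v(2)]] .
    have "(ract m w, ract p (v @ w)) \<in> g"
      using act_relD(3)[OF g'(3) v(2) w(1)] by simp
    then show "\<exists>v\<in>lists A. ract p v \<in> Range (f O g)"
      using v(1) w by (intro bexI[of _ "v @ w"]) auto
  qed
  moreover have "essential_set X A (Domain (f O g))"
    unfolding essential_set_def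
  proof
    fix q assume "q \<in> X \<times> lists A"
    then obtain v m where v: "v \<in> lists A" "(ract q v, m) \<in> f"
      by (rule essential_DomainE[OF f'(4)])
    obtain w p where w: "w \<in> lists A" "(ract m w, p) \<in> g"
      using essential_DomainE[OF g'(4) act_relD(2)[OF f'(3) v(2)]] .
    have "(ract q (v @ w), ract m w) \<in> f"
      using act_relD(3)[OF f'(3) v(2) w(1)] by simp
    then show "\<exists>v\<in>lists A. ract q v \<in> Domain (f O g)"
      using v(1) w by (intro bexI[of _ "v @ w"]) auto
  qed
  ultimately show ?thesis
    using partial_unions_comp[OF f'(1) g'(1)] by (simp add: ess_rels_def)
qed

lemma act_HT_group_mult:
  assumes f: "f \<in> max_ess_isos X A" and g: "g \<in> max_ess_isos X A"
  shows "f \<otimes>\<^bsub>act_HT_group X A\<^esub> g \<in> max_ess_isos X A"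
    and "graph_rel (f \<otimes>\<^bsub>act_HT_group X A\<^esub> g) = max_ext X A (graph_rel f O graph_rel g)"
proof -
  have fg: "graph_rel (f \<circ>\<^sub>m g) \<in> ess_rels X A"
    using f g ess_rels_comp by (simp add: max_ess_isos_iff[OF finite_X finite_A] graph_rel_comp)
  obtain h where h: "h \<in> max_ess_isos X A" "graph_rel h = max_ext X A (graph_rel (f \<circ>\<^sub>m g))"
    using max_ess_iso_obtain[OF finite_X finite_A fg] .
  have "f \<otimes>\<^bsub>act_HT_group X A\<^esub> g = h"
    using max_extension_eq[OF finite_X finite_A fg h] by (simp add: act_HT_group_def)
  then show "f \<otimes>\<^bsub>act_HT_group X A\<^esub> g \<in> max_ess_isos X A"
    "graph_rel (f \<otimes>\<^bsub>act_HT_group X A\<^esub> g) = max_ext X A (graph_rel f O graph_rel g)"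
    using h by (simp_all add: graph_rel_comp)
qed

lemma codense_class_max_ext:
  assumes f: "f \<in> ess_rels X A"
  shows "codense_class (max_ext X A f) = codense_class f"
  using codense_class_eq[OF ess_relsD(1)[OF max_ext_ess_rels[OF finite_X finite_A f]]
      ess_relsD(1)[OF f] codense_max_ext[OF ess_relsD(3)[OF f]]] .

text \<open>Replacing a composite by its maximal extension does not change its class, whence
  multiplicativity. Every class of an essential relation contains its \<open>max_ext\<close>, whence
  surjectivity, and codense fixed points of \<open>max_ext\<close> are equal, whence
  injectivity.\<close>

lemma codense_class_iso:
  "(\<lambda>h. codense_class (graph_rel h)) \<in> iso (act_HT_group X A) (units_of completion)"
proof -
  note max_iff = max_ess_isos_iff[OF finite_X finite_A]
  have carr: "carrier (act_HT_group X A) = max_ess_isos X A"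
    by (simp add: act_HT_group_def)
  have "(\<lambda>h. codense_class (graph_rel h)) \<in> hom (act_HT_group X A) (units_of completion)"
  proof (rule homI)
    fix f assume "f \<in> carrier (act_HT_group X A)"
    then show "codense_class (graph_rel f) \<in> carrier (units_of completion)"
      by (simp add: carr max_iff units_of_carrier Units_completion)
  next
    fix f g assume "f \<in> carrier (act_HT_group X A)" "g \<in> carrier (act_HT_group X A)"
    then have f: "f \<in> max_ess_isos X A" and g: "g \<in> max_ess_isos X A" by (simp_all add: carr)
    then have ess: "graph_rel f \<in> ess_rels X A" "graph_rel g \<in> ess_rels X A"
      by (simp_all add: max_iff)
    have "codense_class (graph_rel (f \<otimes>\<^bsub>act_HT_group X A\<^esub> g)) =
        codense_class (graph_rel f O graph_rel g)"
      unfolding act_HT_group_mult(2)[OF f g] by (rule codense_class_max_ext[OF ess_rels_comp[OF ess]])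
    also have "\<dots> = codense_class (graph_rel f) \<otimes>\<^bsub>units_of completion\<^esub> codense_class (graph_rel g)"
      using completion_mult[OF ess_relsD(1)[OF ess(1)] ess_relsD(1)[OF ess(2)]]
      by (simp add: units_of_mult)
    finally show "codense_class (graph_rel (f \<otimes>\<^bsub>act_HT_group X A\<^esub> g)) =
        codense_class (graph_rel f) \<otimes>\<^bsub>units_of completion\<^esub> codense_class (graph_rel g)" .
  qed
  moreover have "inj_on (\<lambda>h. codense_class (graph_rel h)) (max_ess_isos X A)"
  proof (rule inj_onI)
    fix f g assume f: "f \<in> max_ess_isos X A" and g: "g \<in> max_ess_isos X A"
      and eq: "codense_class (graph_rel f) = codense_class (graph_rel g)"
    have ess: "graph_rel f \<in> ess_rels X A" "graph_rel g \<in> ess_rels X A"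
      and max: "max_ext X A (graph_rel f) = graph_rel f" "max_ext X A (graph_rel g) = graph_rel g"
      using f g by (simp_all add: max_iff)
    have "codense (basics X A) (graph_rel f) (graph_rel g)"
      using eq codense_class_eq_iff[OF ess_relsD(1)[OF ess(1)] ess_relsD(1)[OF ess(2)]] by simp
    then have "graph_rel f = graph_rel g"
      using max_ext_cong[OF ess_relsD(3)[OF ess(1)] ess_relsD(3)[OF ess(2)]] max by simp
    then show "f = g" by simp
  qed
  moreover have "(\<lambda>h. codense_class (graph_rel h)) ` max_ess_isos X A = codense_class ` ess_rels X A"
  proof (intro equalityI subsetI)
    fix u assume "u \<in> codense_class ` ess_rels X A"
    then obtain f where f: "f \<in> ess_rels X A" "u = codense_class f" by blast
    obtain h where "h \<in> max_ess_isos X A" "graph_rel h = max_ext X A f"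
      using max_ess_iso_obtain[OF finite_X finite_A f(1)] .
    then show "u \<in> (\<lambda>h. codense_class (graph_rel h)) ` max_ess_isos X A"
      using codense_class_max_ext[OF f(1)] f(2) by (intro image_eqI[of _ _ h]) simp_all
  qed (auto simp: max_iff)
  ultimately show ?thesis
    by (simp add: iso_def bij_betw_def carr units_of_carrier Units_completion)
qed

lemma units_of_completion_iso: "units_of completion \<cong> act_HT_group X A"
proof -
  have "carrier (act_HT_group X A) = max_ess_isos X A"
    by (simp add: act_HT_group_def)
  then have "inv_into (carrier (act_HT_group X A)) (\<lambda>h. codense_class (graph_rel h))
      \<in> iso (units_of completion) (act_HT_group X A)"
    by (intro iso_inv_into[OF codense_class_iso]) (simp add: act_HT_group_mult(1))
  then show ?thesis unfolding is_iso_def by blast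
qed

end

theorem theorem4p6:
  fixes n r :: nat
  assumes "n \<ge> 2" and "r \<ge> 1"
  shows "monoid (cuntz_monoid n r) \<and> units_of (cuntz_monoid n r) \<cong> higman_thompson n r"
proof -
  let ?\<theta> = "brandt_rel (\<lambda>U. \<Union>(word0_rel {1..n} ` U))"
  interpret P: relation_rep "ext_polycyclic n r" ?\<theta> "basics {1..r} {1..n}"
    by (rule ext_polycyclic_rep)
  have "1 \<in> {1..n}" "2 \<in> {1..n}" "(1::nat) \<noteq> 2" using assms(1) by auto
  \<comment> \<open>The letters 1 and 2 separate the \<open>basic\<close> relations, so the quotient
    by \<leftrightarrow> is represented by the same family as the extended polycyclic
    semigroup.\<close>
  then interpret relation_rep "lenz_quotient (ext_polycyclic n r)" "\<lambda>U. \<Union>(?\<theta> ` U)"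
      "basics {1..r} {1..n}"
    by (intro P.lenz_quotient_rep basics_separated[of 1 _ 2])
  interpret act_rep "lenz_quotient (ext_polycyclic n r)" "\<lambda>U. \<Union>(?\<theta> ` U)" "{1..r}" "{1..n}"
    by unfold_locales simp_all
  show ?thesis
    using monoid_completion units_of_completion_iso
    by (simp add: cuntz_monoid_def dist_completion_def Let_def higman_thompson_def)
qed

end
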